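(* Let $X$ and $Y$ be metric spaces and let $E$ and $F$ be nontrivial normed spaces. A map $T:C_*(X,E)\to C_*(Y,F)$ is a biseparating map if and only if there are a homeomorphism $\varphi:X\to Y$ and functions $\Phi:Y\times E\to F$, $\Psi:X\times F\to E$ such that $(Tf)(y)=\Phi(y,f(\varphi^{-1}(y)))$ for all $f\in C_*(X,E)$ and $y\in Y$, and (1) $\Phi(y,\cdot)$ and $\Psi(x,\cdot)$ are mutual inverses if $\varphi(x)=y$; (2) $\Phi$ is continuous at any point in $Y'\times E$; $\Psi$ is continuous at any point in $X'\times F$; (3) if $B_1$ and $B_2$ are bounded sets in $E$ and $F$ respectively, and for $n\in\mathbb{N}$ $$Z_n(B_1,B_2)=\{x\in X:\ \Phi(\varphi(x),B_1)\not\subseteq nB_F\ \text{ or }\ B_2\not\subseteq\Phi(\varphi(x),nB_E)\},$$ then every sequence $(x_n)\in\prod_n Z_n(B_1,B_2)$ has a subsequence that converges in $X$.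
   Context: $C_*(X,E)$ is the space of bounded continuous functions $X\to E$. $X'$ and $Y'$ denote the sets of accumulation points of $X$ and $Y$; $B_E$ and $B_F$ are the unit balls of $E$ and $F$. For a set $B\subseteq E$, $\Phi(y,B)=\{\Phi(y,e):e\in B\}$. For a function $f$ let $C(f)=\{x: f(x)\neq 0\}$, and for functions $f,g,h$ in the same space write $f\perp_h g$ if $C(f-h)\cap C(g-h)=\emptyset$. A map $T$ (not assumed linear) between two function spaces is biseparating if it is a bijection and for all $f,g,h$ in its domain: $f\perp_h g\iff Tf\perp_{Th}Tg$. *)

theory Defs
  imports "HOL-Analysis.Analysis"
begin

text \<open>
  The space \<open>C\<^sub>*(X, E)\<close> is the library type \<open>('x, 'e) bcontfun\<close> of bounded continuous functions.
\<close>

definition coz :: "('x::topological_space, 'e::real_normed_vector) bcontfun \<Rightarrow> 'x set"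
  where "coz f = {x. apply_bcontfun f x \<noteq> 0}"

definition perp_at ::
    "('x::topological_space, 'e::real_normed_vector) bcontfun \<Rightarrow>
     ('x, 'e) bcontfun \<Rightarrow> ('x, 'e) bcontfun \<Rightarrow> bool"
  where "perp_at h f g \<longleftrightarrow> coz (f - h) \<inter> coz (g - h) = {}"

definition biseparating ::
    "(('x::topological_space, 'e::real_normed_vector) bcontfun \<Rightarrow>
      ('y::topological_space, 'f::real_normed_vector) bcontfun) \<Rightarrow> bool"
  where "biseparating T \<longleftrightarrow>
    bij T \<and> (\<forall>f g h. perp_at h f g \<longleftrightarrow> perp_at (T h) (T f) (T g))"

definition slice_image :: "('y \<times> 'e \<Rightarrow> 'f) \<Rightarrow> 'y \<Rightarrow> 'e set \<Rightarrow> 'f set"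
  where "slice_image \<Phi> y B = (\<lambda>e. \<Phi> (y, e)) ` B"

text \<open>The unit balls \<open>B\<^sub>E\<close> and \<open>B\<^sub>F\<close> are taken to be closed.\<close>

definition Zset ::
    "('x \<Rightarrow> 'y) \<Rightarrow> ('y \<times> 'e::real_normed_vector \<Rightarrow> 'f::real_normed_vector) \<Rightarrow>
     'e set \<Rightarrow> 'f set \<Rightarrow> nat \<Rightarrow> 'x set"
  where "Zset \<phi> \<Phi> B1 B2 n =
    {x. \<not> slice_image \<Phi> (\<phi> x) B1 \<subseteq> (\<lambda>u. real n *\<^sub>R u) ` cball 0 1 \<or>
        \<not> B2 \<subseteq> slice_image \<Phi> (\<phi> x) ((\<lambda>e. real n *\<^sub>R e) ` cball 0 1)}"

end

theory Submission
  imports Defs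
begin

text \<open>
  A map of the form \<open>T f (y) = \<Phi> (y, f (\<phi>\<^sup>-\<^sup>1 y))\<close> with bijective \<open>\<Phi> (y, \<cdot>)\<close>
  reflects and preserves the agreement of two functions at a point, and
  \<open>f \<perp>\<^sub>h g\<close> says that at every point \<open>f\<close> or \<open>g\<close> agrees with
  \<open>h\<close>.  So such a map is biseparating as soon as it is onto.  A preimage of \<open>g\<close> can only
  be \<open>x \<mapsto> \<Psi> (x, g (\<phi> x))\<close>; it is continuous because \<open>\<Psi>\<close> is, and if it were
  unbounded, a sequence along which it grows would lie in the sets \<open>Z\<^sub>n\<close> and therefore
  have a convergent subsequence, where a continuous function is bounded.

  Conversely let \<open>T\<close> be biseparating.  Its values at a point are found by localization.  The
  set where \<open>f\<close> differs from \<open>h\<close> is known up to closure from the functions disjoint from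
  \<open>f\<close> relative to \<open>h\<close>, so that \<open>T\<close> transports such sets.  The transport could depend on
  the base function \<open>h\<close>; lemma \<open>agree_somewhere\<close> shows that it does not.  Two open sets
  are called linked when a perturbation inside the first is turned into a perturbation inside the
  second, and two points correspond when all their neighbourhoods are linked.  Every \<open>x\<close>
  corresponds to exactly one \<open>y\<close>: if the neighbourhoods of \<open>x\<close> were linked to those of two
  disjoint closed sets, a function equal to \<open>T 0\<close> near one of them and to the image of another
  constant near the other would have a preimage that is discontinuous at \<open>x\<close>
  (\<open>not_near_two_closed_sets\<close>).  This applies to two points, giving uniqueness, to a
  point and a closed set, giving continuity of the correspondence, and to two halves of a discrete
  sequence, giving existence.  The latter is where bounded continuous functions on a non-compact
  space could have led to points of a compactification.

  Agreement near \<open>x\<close> is then transported to the corresponding point, and gluing along two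
  interlaced sequences improves this to agreement at \<open>x\<close> alone.  Comparing \<open>f\<close> with the
  constant \<open>f x\<close> yields \<open>\<Phi> (y, e) = T e (y)\<close>, and likewise \<open>\<Psi>\<close> from the
  inverse of \<open>T\<close>.  A failure of continuity of \<open>\<Phi>\<close> at an accumulation point, or of the
  condition on the sets \<open>Z\<^sub>n\<close>, is witnessed by a sequence of points and vectors; a bounded
  continuous function through (a subsequence of) these vectors exists by
  \<open>interpolation_exists\<close>, and its image would be discontinuous or unbounded.
\<close>

section \<open>Bounded continuous functions on a metric space\<close>

lemma isCont_apply_bcontfun:
  fixes f :: "('a::metric_space, 'e::real_normed_vector) bcontfun"
  shows "isCont (apply_bcontfun f) z"
  using apply_bcontfun[of f] by (simp add: bcontfun_def continuous_on_eq_continuous_at)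

text \<open>
  The weight may be discontinuous at points where the two functions agree: there the difference
  it multiplies tends to zero.
\<close>

lemma blend_exists:
  fixes f g :: "('a::metric_space, 'e::real_normed_vector) bcontfun" and \<theta> :: "'a \<Rightarrow> real"
  assumes range: "\<And>z. 0 \<le> \<theta> z \<and> \<theta> z \<le> 1"
    and cont: "\<And>z. apply_bcontfun f z \<noteq> apply_bcontfun g z \<Longrightarrow> isCont \<theta> z"
  obtains h :: "('a, 'e) bcontfun"
  where "\<And>z. apply_bcontfun h z = apply_bcontfun g z + \<theta> z *\<^sub>R (apply_bcontfun f z - apply_bcontfun g z)"
proof -
  define H where "H z = apply_bcontfun g z + \<theta> z *\<^sub>R (apply_bcontfun f z - apply_bcontfun g z)" for z
  note cf = isCont_apply_bcontfun[where f = f] and cg = isCont_apply_bcontfun[where f = g]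
  have "isCont H z" for z
  proof (cases "apply_bcontfun f z = apply_bcontfun g z")
    case False
    show ?thesis unfolding H_def using cont[OF False] cf cg by (intro continuous_intros)
  next
    case True
    have "((\<lambda>w. \<theta> w *\<^sub>R (apply_bcontfun f w - apply_bcontfun g w)) \<longlongrightarrow> 0) (at z)"
    proof (rule tendsto_norm_zero_cancel, rule tendsto_sandwich[OF _ _ tendsto_const])
      show "\<forall>\<^sub>F w in at z. 0 \<le> norm (\<theta> w *\<^sub>R (apply_bcontfun f w - apply_bcontfun g w))" by simp
      show "\<forall>\<^sub>F w in at z. norm (\<theta> w *\<^sub>R (apply_bcontfun f w - apply_bcontfun g w))
              \<le> norm (apply_bcontfun f w - apply_bcontfun g w)"
        using range by (intro always_eventually) (auto intro!: mult_left_le_one_le)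
      have "((\<lambda>w. norm (apply_bcontfun f w - apply_bcontfun g w))
              \<longlongrightarrow> norm (apply_bcontfun f z - apply_bcontfun g z)) (at z)"
        using cf[of z] cg[of z] by (intro tendsto_intros) (auto simp: isCont_def)
      then show "((\<lambda>w. norm (apply_bcontfun f w - apply_bcontfun g w)) \<longlongrightarrow> 0) (at z)"
        using True by simp
    qed
    then have "(H \<longlongrightarrow> apply_bcontfun g z + 0) (at z)"
      unfolding H_def using cg[of z] by (intro tendsto_add) (auto simp: isCont_def)
    moreover have "H z = apply_bcontfun g z" using True by (simp add: H_def)
    ultimately show ?thesis by (simp add: isCont_def)
  qed
  then have "continuous_on UNIV H" by (simp add: continuous_at_imp_continuous_on)
  moreover have "norm (H z) \<le> norm g + (norm f + norm g)" for z
  proof -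
    have "norm (H z) \<le> norm (apply_bcontfun g z)
        + norm (\<theta> z *\<^sub>R (apply_bcontfun f z - apply_bcontfun g z))"
      unfolding H_def by (rule norm_triangle_ineq)
    also have "norm (\<theta> z *\<^sub>R (apply_bcontfun f z - apply_bcontfun g z))
        \<le> norm (apply_bcontfun f z - apply_bcontfun g z)"
      using range[of z] by (auto intro!: mult_left_le_one_le)
    also have "\<dots> \<le> norm (apply_bcontfun f z) + norm (apply_bcontfun g z)"
      by (rule norm_triangle_ineq4)
    finally show ?thesis using norm_bounded[of f z] norm_bounded[of g z] by linarith
  qed
  ultimately have "H \<in> bcontfun" by (rule bcontfun_normI)
  then have "apply_bcontfun (Bcontfun H) z = H z" for z by (simp add: Bcontfun_inverse)
  then show thesis by (intro that[of "Bcontfun H"]) (simp add: H_def)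
qed

lemma bump_exists:
  fixes x0 :: "'a::metric_space"
  assumes "open W" "x0 \<in> W"
  obtains \<theta> :: "'a \<Rightarrow> real"
  where "\<And>z. isCont \<theta> z" "\<And>z. 0 \<le> \<theta> z \<and> \<theta> z \<le> 1" "\<theta> x0 = 1" "\<And>z. \<theta> z \<noteq> 0 \<Longrightarrow> z \<in> W"
proof -
  obtain r where r: "r > 0" "ball x0 r \<subseteq> W" using assms openE by blast
  define \<theta> where "\<theta> z = max 0 (1 - dist z x0 / r)" for z
  show thesis
  proof (rule that[of \<theta>])
    show "isCont \<theta> z" for z unfolding \<theta>_def using r by (intro continuous_intros) auto
    show "0 \<le> \<theta> z \<and> \<theta> z \<le> 1" for z unfolding \<theta>_def using r by auto
    show "\<theta> x0 = 1" by (simp add: \<theta>_def)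
    fix z assume "\<theta> z \<noteq> 0"
    then have "dist z x0 / r < 1" unfolding \<theta>_def by linarith
    then show "z \<in> W" using r by (auto simp: dist_commute subset_iff)
  qed
qed

lemma perturbation_exists:
  fixes b :: "('a::metric_space, 'e::real_normed_vector) bcontfun"
  assumes "\<exists>e::'e. e \<noteq> 0" "open W" "x0 \<in> W"
  obtains c where "apply_bcontfun c x0 \<noteq> apply_bcontfun b x0"
    "\<And>z. apply_bcontfun c z \<noteq> apply_bcontfun b z \<Longrightarrow> z \<in> W"
proof -
  obtain e :: 'e where e: "e \<noteq> 0" using assms by blast
  obtain \<theta> where \<theta>: "\<And>z. isCont \<theta> z" "\<And>z. 0 \<le> \<theta> z \<and> \<theta> z \<le> (1::real)" "\<theta> x0 = 1"
    "\<And>z. \<theta> z \<noteq> 0 \<Longrightarrow> z \<in> W" using bump_exists[OF assms(2,3)] by blast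
  obtain c where c: "\<And>z. apply_bcontfun c z =
      apply_bcontfun b z + \<theta> z *\<^sub>R (apply_bcontfun (b + const_bcontfun e) z - apply_bcontfun b z)"
    using blend_exists[of \<theta> "b + const_bcontfun e" b] \<theta> by metis
  show thesis
  proof (rule that[of c])
    show "apply_bcontfun c x0 \<noteq> apply_bcontfun b x0"
      by (simp add: c \<theta> plus_bcontfun.rep_eq const_bcontfun.rep_eq e)
    show "z \<in> W" if "apply_bcontfun c z \<noteq> apply_bcontfun b z" for z
      using that \<theta>(4)[of z] c[of z] by auto
  qed
qed

text \<open>
  Two functions that agree on the intersection of two closed sets can be glued: the quotient of
  distance functions that serves as a cut-off can be discontinuous only on \<open>A \<inter> A'\<close>, where the two
  functions have the same value.  Getting agreement on open sets, rather than only on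
  \<open>A\<close> and \<open>A'\<close>, matters because a biseparating map is at first only known to
  respect agreement on open sets.
\<close>

lemma glue_exists:
  fixes f g :: "('a::metric_space, 'e::real_normed_vector) bcontfun"
  assumes A: "closed A" "A \<noteq> {}" and A': "closed A'" "A' \<noteq> {}"
    and eq: "\<And>z. z \<in> A \<inter> A' \<Longrightarrow> apply_bcontfun f z = apply_bcontfun g z"
  obtains h G G' where "open G" "A - A' \<subseteq> G" "\<And>z. z \<in> G \<Longrightarrow> apply_bcontfun h z = apply_bcontfun f z"
    "open G'" "A' - A \<subseteq> G'" "\<And>z. z \<in> G' \<Longrightarrow> apply_bcontfun h z = apply_bcontfun g z"
proof -
  define u v where "u z = infdist z A" and "v z = infdist z A'" for z
  have nn: "u z \<ge> 0" "v z \<ge> 0" for z by (auto simp: u_def v_def infdist_nonneg)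
  have u0: "u z = 0 \<longleftrightarrow> z \<in> A" and v0: "v z = 0 \<longleftrightarrow> z \<in> A'" for z
    using in_closed_iff_infdist_zero A A' by (auto simp: u_def v_def)
  have cu: "isCont u z" and cv: "isCont v z" for z
    unfolding u_def v_def by (intro continuous_intros)+
  then have cuU: "continuous_on UNIV u" "continuous_on UNIV v"
    by (auto simp: continuous_at_imp_continuous_on)
  define \<theta> where "\<theta> z = max 0 (min 1 (3 * v z / (u z + v z) - 1))" for z
  obtain h where h: "\<And>z. apply_bcontfun h z =
      apply_bcontfun g z + \<theta> z *\<^sub>R (apply_bcontfun f z - apply_bcontfun g z)"
  proof (rule blend_exists[of \<theta> f g])
    show "0 \<le> \<theta> z \<and> \<theta> z \<le> 1" for z by (auto simp: \<theta>_def)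
    fix z assume "apply_bcontfun f z \<noteq> apply_bcontfun g z"
    then have "\<not> (u z = 0 \<and> v z = 0)" using eq[of z] u0[of z] v0[of z] by blast
    then have "u z + v z \<noteq> 0" using nn[of z] by linarith
    then show "isCont \<theta> z" unfolding \<theta>_def using cu cv by (intro continuous_intros) auto
  qed blast
  show thesis
  proof (rule that[of "{z. 2 * u z < v z}" h "{z. 2 * v z < u z}"])
    show "open {z. 2 * u z < v z}" using cuU by (intro open_Collect_less continuous_intros)
    show "open {z. 2 * v z < u z}" using cuU by (intro open_Collect_less continuous_intros)
    show "A - A' \<subseteq> {z. 2 * u z < v z}"
    proof
      fix z assume "z \<in> A - A'"
      then have "u z = 0" "v z \<noteq> 0" using u0[of z] v0[of z] by auto
      then show "z \<in> {z. 2 * u z < v z}" using nn[of z] by simp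
    qed
    show "A' - A \<subseteq> {z. 2 * v z < u z}"
    proof
      fix z assume "z \<in> A' - A"
      then have "v z = 0" "u z \<noteq> 0" using u0[of z] v0[of z] by auto
      then show "z \<in> {z. 2 * v z < u z}" using nn[of z] by simp
    qed
    show "apply_bcontfun h z = apply_bcontfun f z" if "z \<in> {z. 2 * u z < v z}" for z
    proof -
      have "3 * v z / (u z + v z) \<ge> 2" using that nn[of z] by (simp add: field_simps)
      then have "\<theta> z = 1" by (simp add: \<theta>_def)
      then show ?thesis by (simp add: h)
    qed
    show "apply_bcontfun h z = apply_bcontfun g z" if "z \<in> {z. 2 * v z < u z}" for z
    proof -
      have "3 * v z / (u z + v z) \<le> 1" using that nn[of z] by (simp add: field_simps)
      then have "\<theta> z = 0" by (simp add: \<theta>_def)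
      then show ?thesis by (simp add: h)
    qed
  qed
qed

text \<open>
  Disjoint cones of height \<open>v n\<close> are placed over the points \<open>x n\<close>.  The radii tend to
  zero, so that cones can only accumulate at limit points of the sequence; there the heights
  tend to zero by assumption.
\<close>

lemma interpolation_exists:
  fixes x :: "nat \<Rightarrow> 'a::metric_space" and v :: "nat \<Rightarrow> 'e::real_normed_vector"
  assumes inj: "inj x" and iso: "\<And>n. \<not> x n islimpt range x" and bdd: "bounded (range v)"
    and lim: "\<And>z. z islimpt range x \<Longrightarrow> v \<longlonglongrightarrow> 0"
  obtains f :: "('a, 'e) bcontfun" where "\<And>n. apply_bcontfun f (x n) = v n"
proof -
  have "\<exists>d>0. \<forall>m. m \<noteq> n \<longrightarrow> d \<le> dist (x m) (x n)" for n
  proof -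
    obtain d where "d > 0" "\<And>y. y \<in> range x \<Longrightarrow> y \<noteq> x n \<Longrightarrow> d \<le> dist y (x n)"
      using iso[of n] unfolding islimpt_approachable by (metis not_le)
    then show ?thesis using inj by (metis injD rangeI)
  qed
  then obtain \<rho> where \<rho>: "\<And>n. \<rho> n > 0" "\<And>n m. m \<noteq> n \<Longrightarrow> \<rho> n \<le> dist (x m) (x n)" by metis
  define r where "r n = min (\<rho> n) (1 / real (Suc n)) / 2" for n
  have r0: "r n > 0" for n using \<rho>(1)[of n] by (simp add: r_def)
  have r1: "r n \<le> \<rho> n / 2" "r n < 1 / real (Suc n)" for n
    using \<rho>(1)[of n] by (auto simp: r_def field_simps min_def)
  define hat where "hat n z = max 0 (1 - dist z (x n) / r n)" for n z
  have hat01: "0 \<le> hat n z" "hat n z \<le> 1" for n z using r0[of n] by (auto simp: hat_def)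
  have hat_pos: "dist z (x n) < r n" if "hat n z > 0" for n z
  proof -
    have "dist z (x n) / r n < 1" using that by (auto simp: hat_def less_max_iff_disj)
    then show ?thesis using r0[of n] by (simp add: field_simps)
  qed
  have disj: "n = m" if "hat n z > 0" "hat m z > 0" for n m z
  proof (rule ccontr)
    assume ne: "n \<noteq> m"
    have "dist (x m) (x n) \<le> dist z (x m) + dist z (x n)" by (metis dist_commute dist_triangle)
    then have "dist (x m) (x n) < r m + r n" using hat_pos[OF that(1)] hat_pos[OF that(2)] by linarith
    moreover have "\<rho> n \<le> dist (x m) (x n)" "\<rho> m \<le> dist (x m) (x n)"
      using \<rho>(2)[of m n] \<rho>(2)[of n m] ne by (auto simp: dist_commute)
    ultimately show False using r1(1)[of n] r1(1)[of m] by linarith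
  qed
  define k where "k z = (SOME n. hat n z > 0)" for z
  have k: "k z = n" if "hat n z > 0" for n z
    using disj[of "k z" z n] that someI[of "\<lambda>n. hat n z > 0" n] by (simp add: k_def)
  have hat0: "hat n z = 0" if "n \<noteq> k z" for n z using k[of n z] hat01[of n z] that by fastforce
  define F where "F z = hat (k z) z *\<^sub>R v (k z)" for z
  define S where "S N z = (\<Sum>n<N. hat n z *\<^sub>R v n)" for N z
  have S: "S N z = (if k z < N then F z else 0)" for N z
  proof -
    have "S N z = (\<Sum>n<N. if n = k z then F z else 0)"
      unfolding S_def by (intro sum.cong) (auto simp: F_def hat0)
    then show ?thesis by simp
  qed
  have Fle: "norm (F z) \<le> norm (v (k z))" for z
    unfolding F_def using hat01 by (auto intro!: mult_left_le_one_le)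
  have tail: "\<exists>N d. d > 0 \<and> (\<forall>z. dist z z0 < d \<longrightarrow> norm (F z - S N z) \<le> e)" if e: "e > 0" for z0 e
  proof (cases "z0 islimpt range x")
    case True
    then obtain N where N: "\<And>n. n \<ge> N \<Longrightarrow> norm (v n) < e"
      using lim[OF True] e unfolding lim_sequentially by auto
    have "norm (F z - S N z) \<le> e" for z
      using N[of "k z"] Fle[of z] e by (auto simp: S)
    then show ?thesis by (intro exI[of _ N] exI[of _ 1]) simp
  next
    case False
    then obtain d where d: "d > 0" "\<And>y. y \<in> range x \<Longrightarrow> y \<noteq> z0 \<Longrightarrow> d \<le> dist y z0"
      unfolding islimpt_approachable by (metis not_le)
    obtain N1 where N1: "1 / real (Suc N1) < d / 2" using d(1) nat_approx_posE[of "d/2"] by auto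
    obtain N2 where N2: "\<And>n. x n = z0 \<Longrightarrow> n < N2"
      using inj by (metis injD lessI)
    define N where "N = max N1 N2"
    have "F z = S N z" if z: "dist z z0 < d / 2" for z
    proof (cases "k z < N")
      case False
      have "hat (k z) z = 0"
      proof (rule ccontr)
        assume "hat (k z) z \<noteq> 0"
        then have "dist z (x (k z)) < r (k z)" using hat01(1)[of "k z" z] hat_pos by fastforce
        also have "r (k z) < 1 / real (Suc (k z))" by (rule r1)
        also have "\<dots> \<le> 1 / real (Suc N1)" using False by (simp add: N_def frac_le)
        finally have "dist z (x (k z)) < d / 2" using N1 by linarith
        then have "dist (x (k z)) z0 < d" using z
          by (metis dist_commute dist_triangle_half_l)
        moreover have "x (k z) \<noteq> z0" using N2[of "k z"] False by (auto simp: N_def)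
        ultimately show False using d(2)[of "x (k z)"] by auto
      qed
      then show ?thesis using False by (simp add: S F_def)
    qed (simp add: S)
    then show ?thesis using d e by (intro exI[of _ N] exI[of _ "d/2"]) auto
  qed
  have contS: "isCont (S N) z" for N z
    unfolding S_def hat_def using r0 by (intro continuous_intros) (auto simp: less_imp_neq[THEN not_sym])
  have "isCont F z0" for z0
    unfolding continuous_at_eps_delta
  proof (intro allI impI)
    fix e :: real assume e: "e > 0"
    obtain N d1 where d1: "d1 > 0" "\<And>z. dist z z0 < d1 \<Longrightarrow> norm (F z - S N z) \<le> e/4"
      using tail[of "e/4" z0] e by auto
    obtain d2 where d2: "d2 > 0" "\<And>z. dist z z0 < d2 \<Longrightarrow> dist (S N z) (S N z0) < e/4"
      using contS[where N = N and z = z0] e unfolding continuous_at_eps_delta by (metis divide_pos_pos zero_less_numeral)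
    have "dist (F z) (F z0) < e" if "dist z z0 < min d1 d2" for z
    proof -
      have "dist (F z) (F z0) \<le> dist (F z) (S N z) + dist (S N z) (S N z0) + dist (S N z0) (F z0)"
        by (metis add.commute add_left_mono dist_triangle order_trans add.assoc)
      moreover have "dist (F z) (S N z) \<le> e/4" "dist (S N z0) (F z0) \<le> e/4"
        using d1(2)[of z] d1(2)[of z0] d1(1) that by (auto simp: dist_norm norm_minus_commute)
      ultimately show ?thesis using d2(2)[of z] that e by simp
    qed
    then show "\<exists>d>0. \<forall>z. dist z z0 < d \<longrightarrow> dist (F z) (F z0) < e"
      using d1(1) d2(1) by (intro exI[of _ "min d1 d2"]) auto
  qed
  then have "continuous_on UNIV F" by (simp add: continuous_at_imp_continuous_on)
  moreover obtain B where "\<And>n. norm (v n) \<le> B" using bdd by (auto simp: bounded_iff)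
  then have "\<And>z. norm (F z) \<le> B" using Fle order_trans by blast
  ultimately have "F \<in> bcontfun" by (rule bcontfun_normI)
  then have ap: "apply_bcontfun (Bcontfun F) = F" by (simp add: Bcontfun_inverse)
  have "F (x n) = v n" for n
  proof -
    have h1: "hat n (x n) = 1" by (simp add: hat_def)
    then have "k (x n) = n" by (intro k) simp
    then show ?thesis by (simp add: F_def h1)
  qed
  then show thesis using that[of "Bcontfun F"] ap by simp
qed

text \<open>
  The predicate \<open>Q\<close> lets further data be attached to the terms of the sequence, with an
  accuracy \<open>d\<close> that tends to zero along it.
\<close>

lemma injective_sequence_to_point:
  fixes x :: "'a::metric_space"
  assumes ex: "\<And>d. d > 0 \<Longrightarrow> \<exists>z. z \<noteq> x \<and> dist z x < d \<and> Q d z"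
  obtains \<sigma> where "inj \<sigma>" "\<And>n. \<sigma> n \<noteq> x" "\<sigma> \<longlonglongrightarrow> x"
    "\<And>n. \<exists>d. 0 < d \<and> d \<le> 1 / real (Suc n) \<and> Q d (\<sigma> n)"
proof -
  define P where "P n z \<longleftrightarrow> z \<noteq> x \<and> dist z x < 1 / real (Suc n) \<and>
      (\<exists>d. 0 < d \<and> d \<le> 1 / real (Suc n) \<and> Q d z)" for n z
  have "\<exists>\<sigma>. \<forall>n. P n (\<sigma> n) \<and> dist (\<sigma> (Suc n)) x < dist (\<sigma> n) x"
  proof (rule dependent_nat_choice)
    show "\<exists>z. P 0 z" using ex[of 1] unfolding P_def by (auto intro!: exI[of _ 1])
    fix z n assume "P n z"
    then have "min (dist z x) (1 / real (Suc (Suc n))) > 0" by (auto simp: P_def)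
    then obtain w where "w \<noteq> x" "dist w x < min (dist z x) (1 / real (Suc (Suc n)))"
        "Q (min (dist z x) (1 / real (Suc (Suc n)))) w" using ex by blast
    then have "P (Suc n) w \<and> dist w x < dist z x"
      unfolding P_def using \<open>min (dist z x) (1 / real (Suc (Suc n))) > 0\<close>
      by (intro conjI exI[of _ "min (dist z x) (1 / real (Suc (Suc n)))"]) simp_all
    then show "\<exists>w. P (Suc n) w \<and> dist w x < dist z x" by blast
  qed
  then obtain \<sigma> where \<sigma>: "\<And>n. P n (\<sigma> n)" "\<And>n. dist (\<sigma> (Suc n)) x < dist (\<sigma> n) x" by blast
  have dec: "dist (\<sigma> n) x < dist (\<sigma> m) x" if "m < n" for m n
    using lift_Suc_mono_less[of "\<lambda>n. - dist (\<sigma> n) x" m n] \<sigma>(2) that by simp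
  show thesis
  proof (rule that)
    show "inj \<sigma>" by (rule linorder_injI) (use dec in fastforce)
    show "\<sigma> n \<noteq> x" for n using \<sigma>(1)[of n] by (simp add: P_def)
    show "\<exists>d. 0 < d \<and> d \<le> 1 / real (Suc n) \<and> Q d (\<sigma> n)" for n
      using \<sigma>(1)[of n] by (simp add: P_def)
    have "(\<lambda>n. dist (\<sigma> n) x) \<longlonglongrightarrow> 0"
    proof (rule tendsto_sandwich[OF _ _ tendsto_const LIMSEQ_inverse_real_of_nat])
      show "\<forall>\<^sub>F n in sequentially. dist (\<sigma> n) x \<le> inverse (real (Suc n))"
        using \<sigma>(1) by (intro always_eventually) (auto simp: P_def inverse_eq_divide less_imp_le)
    qed simp
    then show "\<sigma> \<longlonglongrightarrow> x" using tendsto_dist_iff by blast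
  qed
qed

lemma closed_convergent_sequence:
  fixes \<sigma> :: "nat \<Rightarrow> 'a::metric_space"
  assumes "\<sigma> \<longlonglongrightarrow> x"
  shows "closed (insert x (range \<sigma>))"
  using sequence_unique_limpt[OF assms] by (auto simp: closed_limpt islimpt_insert)

section \<open>Corresponding points\<close>

lemma perp_at_iff:
  "perp_at h f g \<longleftrightarrow>
    (\<forall>x. apply_bcontfun f x = apply_bcontfun h x \<or> apply_bcontfun g x = apply_bcontfun h x)"
  by (auto simp: perp_at_def coz_def minus_bcontfun.rep_eq disjoint_iff)

lemma biseparating_inv:
  assumes "biseparating T"
  shows "biseparating (inv T)"
proof -
  have bij: "bij T" using assms by (simp add: biseparating_def)
  then have "T (inv T f) = f" for f by (simp add: bij_is_surj surj_f_inv_f)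
  then have "perp_at h f g \<longleftrightarrow> perp_at (inv T h) (inv T f) (inv T g)" for f g h
    using assms unfolding biseparating_def by metis
  then show ?thesis using bij by (simp add: biseparating_def bij_imp_bij_inv)
qed

lemma biseparating_pointwise:
  assumes "biseparating T"
    and "\<And>x. apply_bcontfun f x = apply_bcontfun h x \<or> apply_bcontfun g x = apply_bcontfun h x"
  shows "apply_bcontfun (T f) y = apply_bcontfun (T h) y \<or> apply_bcontfun (T g) y = apply_bcontfun (T h) y"
  using assms unfolding biseparating_def perp_at_iff by blast

lemma biseparating_pointwise_rev:
  assumes "biseparating T"
    and "\<And>y. apply_bcontfun (T f) y = apply_bcontfun (T h) y \<or> apply_bcontfun (T g) y = apply_bcontfun (T h) y"
  shows "apply_bcontfun f x = apply_bcontfun h x \<or> apply_bcontfun g x = apply_bcontfun h x"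
  using assms unfolding biseparating_def perp_at_iff by blast

lemma open_differ:
  fixes f g :: "('a::topological_space, 'e::real_normed_vector) bcontfun"
  shows "open {x. apply_bcontfun f x \<noteq> apply_bcontfun g x}"
  by (intro open_Collect_neq continuous_on_apply_bcontfun)

lemma closed_agree:
  fixes f g :: "('a::topological_space, 'e::real_normed_vector) bcontfun"
  shows "closed {x. apply_bcontfun f x = apply_bcontfun g x}"
  by (intro closed_Collect_eq continuous_on_apply_bcontfun)

text \<open>
  If \<open>T f\<close> differed from \<open>T h\<close> at a point away from the closure of the set where
  \<open>T g\<close> differs from \<open>T h\<close>, some \<open>T k\<close> would differ from \<open>T h\<close>
  there and nowhere on that set.  Then \<open>k\<close> would be disjoint from \<open>g\<close>, hence from
  \<open>f\<close>, relative to \<open>h\<close>, so that \<open>T k\<close> and \<open>T f\<close> could not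
  both differ from \<open>T h\<close> at one point.
\<close>

lemma differ_mono:
  fixes T :: "('x::metric_space, 'e::real_normed_vector) bcontfun \<Rightarrow>
              ('y::metric_space, 'f::real_normed_vector) bcontfun"
  assumes T: "biseparating T" and nt: "\<exists>u::'f. u \<noteq> 0"
    and sub: "\<And>x. apply_bcontfun f x \<noteq> apply_bcontfun h x \<Longrightarrow> apply_bcontfun g x \<noteq> apply_bcontfun h x"
    and y: "apply_bcontfun (T f) y \<noteq> apply_bcontfun (T h) y"
  shows "y \<in> closure {y. apply_bcontfun (T g) y \<noteq> apply_bcontfun (T h) y}"
proof (rule ccontr)
  assume "y \<notin> closure {y. apply_bcontfun (T g) y \<noteq> apply_bcontfun (T h) y}"
  then obtain K where K: "apply_bcontfun K y \<noteq> apply_bcontfun (T h) y"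
    "\<And>z. apply_bcontfun K z \<noteq> apply_bcontfun (T h) z \<Longrightarrow>
       z \<in> - closure {y. apply_bcontfun (T g) y \<noteq> apply_bcontfun (T h) y}"
    using perturbation_exists[OF nt, of "- closure {y. apply_bcontfun (T g) y \<noteq> apply_bcontfun (T h) y}" y "T h"]
    by auto
  obtain k where k: "K = T k" using T unfolding biseparating_def by (metis bij_pointE)
  have "apply_bcontfun (T k) z = apply_bcontfun (T h) z \<or> apply_bcontfun (T g) z = apply_bcontfun (T h) z" for z
    using K(2)[of z] closure_subset[of "{y. apply_bcontfun (T g) y \<noteq> apply_bcontfun (T h) y}"]
    by (auto simp: k)
  from biseparating_pointwise_rev[OF T this]
  have "apply_bcontfun k x = apply_bcontfun h x \<or> apply_bcontfun f x = apply_bcontfun h x" for x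
    using sub by blast
  from biseparating_pointwise[OF T this, of y] show False using K(1) y by (simp add: k)
qed

text \<open>
  Near \<open>x0\<close> the function \<open>m\<close> of the proof equals \<open>b\<close>, and it equals
  \<open>p\<close> outside the set where \<open>p\<close> differs from \<open>q\<close>.  The second property
  forces \<open>T m = T p\<close> on \<open>G\<close>.  By the first, a small perturbation of \<open>b\<close>
  at \<open>x0\<close> can be regarded as one of \<open>m\<close>, and its effect on the image side is
  confined to the closure of \<open>G\<close>, where \<open>T m = T p\<close>.  So \<open>p\<close> is disjoint from this perturbation relative to
  \<open>m\<close>, although both differ from \<open>m\<close> at \<open>x0\<close>.
\<close>

lemma agree_somewhere_aux:
  fixes T :: "('x::metric_space, 'e::real_normed_vector) bcontfun \<Rightarrow>
              ('y::metric_space, 'f::real_normed_vector) bcontfun"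
  assumes T: "biseparating T" and nt: "\<exists>e::'e. e \<noteq> 0" "\<exists>u::'f. u \<noteq> 0"
    and G: "open G"
    and ab: "\<And>y. apply_bcontfun (T a) y \<noteq> apply_bcontfun (T b) y \<Longrightarrow> y \<in> G"
    and pq: "\<And>y. y \<in> G \<Longrightarrow> apply_bcontfun (T p) y = apply_bcontfun (T q) y"
    and x0: "apply_bcontfun a x0 \<noteq> apply_bcontfun b x0" "apply_bcontfun p x0 \<noteq> apply_bcontfun b x0"
    and ne: "\<And>x. apply_bcontfun a x \<noteq> apply_bcontfun b x \<Longrightarrow> apply_bcontfun p x \<noteq> apply_bcontfun q x"
  shows False
proof -
  define W where "W = {x. apply_bcontfun a x \<noteq> apply_bcontfun b x} \<inter> {x. apply_bcontfun p x \<noteq> apply_bcontfun b x}"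
  have W: "open W" "x0 \<in> W" unfolding W_def using x0 open_differ by (auto intro!: open_Int)
  obtain \<rho> where \<rho>: "\<And>z. isCont \<rho> z" "\<And>z. 0 \<le> \<rho> z \<and> \<rho> z \<le> (1::real)" "\<rho> x0 = 1"
    "\<And>z. \<rho> z \<noteq> 0 \<Longrightarrow> z \<in> W" using bump_exists[OF W] by blast
  define O1 where "O1 = {z. \<rho> z > 1/2}"
  have "continuous_on UNIV \<rho>" using \<rho>(1) by (simp add: continuous_at_imp_continuous_on)
  then have "open O1" unfolding O1_def by (intro open_Collect_less continuous_intros)
  moreover have "x0 \<in> O1" using \<rho>(3) by (simp add: O1_def)
  ultimately have O1: "open O1" "x0 \<in> O1" .
  obtain m where m: "\<And>z. apply_bcontfun m z =
      apply_bcontfun p z + min 1 (2 * \<rho> z) *\<^sub>R (apply_bcontfun b z - apply_bcontfun p z)"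
  proof (rule blend_exists[of "\<lambda>z. min 1 (2 * \<rho> z)" b p])
    show "0 \<le> min 1 (2 * \<rho> z) \<and> min 1 (2 * \<rho> z) \<le> 1" for z using \<rho>(2)[of z] by simp
    show "isCont (\<lambda>z. min 1 (2 * \<rho> z)) z" for z using \<rho>(1)[of z] by (intro continuous_intros)
  qed blast
  have m_b: "apply_bcontfun m z = apply_bcontfun b z" if "z \<in> O1" for z
    using that by (simp add: m O1_def)
  have m_p: "z \<in> W" if "apply_bcontfun m z \<noteq> apply_bcontfun p z" for z
    using that \<rho>(4)[of z] by (auto simp: m)
  obtain c where c: "apply_bcontfun c x0 \<noteq> apply_bcontfun b x0"
    "\<And>z. apply_bcontfun c z \<noteq> apply_bcontfun b z \<Longrightarrow> z \<in> O1"
    using perturbation_exists[OF nt(1) O1] by blast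
  define c' where "c' = m + (c - b)"
  have c': "apply_bcontfun c' z = apply_bcontfun m z + (apply_bcontfun c z - apply_bcontfun b z)" for z
    by (simp add: c'_def plus_bcontfun.rep_eq minus_bcontfun.rep_eq)
  have c'c: "apply_bcontfun c' z = apply_bcontfun c z" if "z \<in> O1" for z using m_b[OF that] by (simp add: c')
  have c'm: "apply_bcontfun c' z = apply_bcontfun m z" if "z \<notin> O1" for z using c(2)[of z] that by (auto simp: c')
  \<comment> \<open>Moving the base function from \<open>b\<close> to \<open>m\<close>, which agrees with \<open>b\<close> where
    \<open>c\<close> differs from \<open>b\<close>, does not enlarge the set where the images differ.\<close>
  have V: "apply_bcontfun (T c) y \<noteq> apply_bcontfun (T b) y" if "apply_bcontfun (T c') y \<noteq> apply_bcontfun (T m) y" for y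
  proof -
    have "apply_bcontfun (T c') y = apply_bcontfun (T m) y \<or> apply_bcontfun (T b) y = apply_bcontfun (T m) y"
      by (rule biseparating_pointwise[OF T]) (metis c'm m_b)
    moreover have "apply_bcontfun (T c) y = apply_bcontfun (T c') y \<or> apply_bcontfun (T m) y = apply_bcontfun (T c') y"
      by (rule biseparating_pointwise[OF T]) (metis c'c c'm)
    ultimately show ?thesis using that by metis
  qed
  have mp: "apply_bcontfun (T m) y = apply_bcontfun (T p) y" if y: "y \<in> G" for y
  proof (rule ccontr)
    assume "apply_bcontfun (T m) y \<noteq> apply_bcontfun (T p) y"
    then have "y \<in> closure {y. apply_bcontfun (T q) y \<noteq> apply_bcontfun (T p) y}"
      by (rule differ_mono[OF T nt(2), rotated]) (use m_p ne in \<open>force simp: W_def\<close>)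
    then obtain y' where "y' \<in> G" "apply_bcontfun (T q) y' \<noteq> apply_bcontfun (T p) y'"
      using G y by (auto simp: closure_iff_nhds_not_empty)
    then show False using pq[of y'] by simp
  qed
  have "apply_bcontfun (T c') y = apply_bcontfun (T m) y \<or> apply_bcontfun (T p) y = apply_bcontfun (T m) y" for y
  proof (rule ccontr)
    assume neg: "\<not> ?thesis"
    then have y: "apply_bcontfun (T c) y \<noteq> apply_bcontfun (T b) y" using V by blast
    have "y \<in> closure {y. apply_bcontfun (T a) y \<noteq> apply_bcontfun (T b) y}"
      by (rule differ_mono[OF T nt(2) _ y]) (use c(2) \<rho>(4) in \<open>force simp: O1_def W_def\<close>)
    moreover have "apply_bcontfun (T m) y \<noteq> apply_bcontfun (T p) y" using neg by metis
    ultimately obtain y' where "apply_bcontfun (T m) y' \<noteq> apply_bcontfun (T p) y'"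
        "apply_bcontfun (T a) y' \<noteq> apply_bcontfun (T b) y'"
      using open_differ[of "T m" "T p"] unfolding closure_iff_nhds_not_empty by blast
    then show False using mp ab by blast
  qed
  from biseparating_pointwise_rev[OF T this, of x0] show False
    using c'c[OF O1(2)] m_b[OF O1(2)] c(1) x0(2) by simp
qed

text \<open>
  The base functions \<open>b\<close> and \<open>q\<close> are unrelated, which makes this the statement
  that the transport of open sets by \<open>T\<close> is independent of the base.  At a point where
  \<open>p\<close> and \<open>q\<close> differ one of them differs from \<open>b\<close>, so the auxiliary lemma
  applies with the two in one order or the other.
\<close>

lemma agree_somewhere:
  fixes T :: "('x::metric_space, 'e::real_normed_vector) bcontfun \<Rightarrow>
              ('y::metric_space, 'f::real_normed_vector) bcontfun"
  assumes T: "biseparating T" and nt: "\<exists>e::'e. e \<noteq> 0" "\<exists>u::'f. u \<noteq> 0"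
    and G: "open G"
    and ab: "\<And>y. apply_bcontfun (T a) y \<noteq> apply_bcontfun (T b) y \<Longrightarrow> y \<in> G"
    and pq: "\<And>y. y \<in> G \<Longrightarrow> apply_bcontfun (T p) y = apply_bcontfun (T q) y"
    and neq: "a \<noteq> b"
  obtains x where "apply_bcontfun a x \<noteq> apply_bcontfun b x" "apply_bcontfun p x = apply_bcontfun q x"
proof -
  obtain x0 where x0: "apply_bcontfun a x0 \<noteq> apply_bcontfun b x0"
    using neq by (metis bcontfun_eqI)
  have "\<exists>x. apply_bcontfun a x \<noteq> apply_bcontfun b x \<and> apply_bcontfun p x = apply_bcontfun q x"
  proof (rule ccontr)
    assume none: "\<not> ?thesis"
    then have "apply_bcontfun p x0 \<noteq> apply_bcontfun b x0 \<or> apply_bcontfun q x0 \<noteq> apply_bcontfun b x0"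
      using x0 by metis
    then show False
      using agree_somewhere_aux[OF T nt G ab pq x0] agree_somewhere_aux[OF T nt G ab pq[symmetric] x0] none
      by metis
  qed
  then show thesis using that by blast
qed

text \<open>
  The condition is symmetric: exchanging \<open>U\<close> and \<open>V\<close> amounts to replacing a
  bijective \<open>T\<close> by its inverse.  This makes the correspondence of points derived from it automatically bijective once it is
  known to be a function for every biseparating map.
\<close>

definition linked ::
    "(('x::topological_space, 'e::real_normed_vector) bcontfun \<Rightarrow>
      ('y::topological_space, 'f::real_normed_vector) bcontfun) \<Rightarrow> 'x set \<Rightarrow> 'y set \<Rightarrow> bool"
  where "linked T U V \<longleftrightarrow> (\<exists>a b. a \<noteq> b \<and>
    (\<forall>x. apply_bcontfun a x \<noteq> apply_bcontfun b x \<longrightarrow> x \<in> U) \<and>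
    (\<forall>y. apply_bcontfun (T a) y \<noteq> apply_bcontfun (T b) y \<longrightarrow> y \<in> V))"

definition corresponds ::
    "(('x::topological_space, 'e::real_normed_vector) bcontfun \<Rightarrow>
      ('y::topological_space, 'f::real_normed_vector) bcontfun) \<Rightarrow> 'x \<Rightarrow> 'y \<Rightarrow> bool"
  where "corresponds T x y \<longleftrightarrow>
    (\<forall>U V. open U \<and> x \<in> U \<and> open V \<and> y \<in> V \<longrightarrow> linked T U V)"

lemma linked_mono: "linked T U V \<Longrightarrow> U \<subseteq> U' \<Longrightarrow> V \<subseteq> V' \<Longrightarrow> linked T U' V'"
  unfolding linked_def by blast

lemma linked_inv:
  assumes "bij T"
  shows "linked (inv T) V U \<longleftrightarrow> linked T U V"
proof
  assume "linked (inv T) V U"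
  then obtain a b where ab: "a \<noteq> b" "\<forall>x. apply_bcontfun a x \<noteq> apply_bcontfun b x \<longrightarrow> x \<in> V"
    "\<forall>y. apply_bcontfun (inv T a) y \<noteq> apply_bcontfun (inv T b) y \<longrightarrow> y \<in> U"
    unfolding linked_def by blast
  moreover have "T (inv T a) = a" "T (inv T b) = b" using assms by (simp_all add: bij_is_surj surj_f_inv_f)
  ultimately show "linked T U V" unfolding linked_def
    by (intro exI[of _ "inv T a"] exI[of _ "inv T b"]) auto
next
  assume "linked T U V"
  then obtain a b where ab: "a \<noteq> b" "\<forall>x. apply_bcontfun a x \<noteq> apply_bcontfun b x \<longrightarrow> x \<in> U"
    "\<forall>y. apply_bcontfun (T a) y \<noteq> apply_bcontfun (T b) y \<longrightarrow> y \<in> V"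
    unfolding linked_def by blast
  moreover have "inv T (T a) = a" "inv T (T b) = b" using assms by (simp_all add: bij_is_inj)
  ultimately show "linked (inv T) V U" unfolding linked_def
    by (intro exI[of _ "T a"] exI[of _ "T b"]) auto
qed

lemma corresponds_inv:
  assumes "bij T"
  shows "corresponds (inv T) y x \<longleftrightarrow> corresponds T x y"
  using linked_inv[OF assms] unfolding corresponds_def by blast

text \<open>
  Gluing the images of the constants \<open>0\<close> and \<open>e\<close> along the two closed sets gives
  some \<open>T p\<close>.  Every neighbourhood of \<open>x\<close> then contains points where \<open>p\<close> is
  \<open>0\<close> and points where it is \<open>e\<close>.
\<close>

lemma not_near_two_closed_sets:
  fixes T :: "('x::metric_space, 'e::real_normed_vector) bcontfun \<Rightarrow>
              ('y::metric_space, 'f::real_normed_vector) bcontfun"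
  assumes T: "biseparating T" and nt: "\<exists>e::'e. e \<noteq> 0" "\<exists>u::'f. u \<noteq> 0"
    and S: "closed S" "S \<noteq> {}" and S': "closed S'" "S' \<noteq> {}" and disj: "S \<inter> S' = {}"
    and near: "\<And>U G. open U \<Longrightarrow> x \<in> U \<Longrightarrow> open G \<Longrightarrow> S \<subseteq> G \<Longrightarrow> linked T U G"
    and near': "\<And>U G. open U \<Longrightarrow> x \<in> U \<Longrightarrow> open G \<Longrightarrow> S' \<subseteq> G \<Longrightarrow> linked T U G"
  shows False
proof -
  obtain e :: 'e where e: "e \<noteq> 0" using nt by blast
  define f1 f2 where "f1 = (const_bcontfun 0 :: ('x, 'e) bcontfun)" and "f2 = (const_bcontfun e :: ('x, 'e) bcontfun)"
  obtain h G G' where h: "open G" "S - S' \<subseteq> G" "\<And>z. z \<in> G \<Longrightarrow> apply_bcontfun h z = apply_bcontfun (T f1) z"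
    "open G'" "S' - S \<subseteq> G'" "\<And>z. z \<in> G' \<Longrightarrow> apply_bcontfun h z = apply_bcontfun (T f2) z"
  proof (rule glue_exists[OF S S'])
    show "apply_bcontfun (T f1) z = apply_bcontfun (T f2) z" if "z \<in> S \<inter> S'" for z
      using that disj by blast
  qed blast
  have SG: "S \<subseteq> G" "S' \<subseteq> G'" using h(2,5) disj by auto
  obtain p where p: "h = T p" using T unfolding biseparating_def by (metis bij_pointE)
  have key: "apply_bcontfun p x = apply_bcontfun q x"
    if O: "open O'" "\<And>z. z \<in> O' \<Longrightarrow> apply_bcontfun (T p) z = apply_bcontfun (T q) z"
      and l: "\<And>U. open U \<Longrightarrow> x \<in> U \<Longrightarrow> linked T U O'" for q O'
  proof (rule ccontr)
    assume "apply_bcontfun p x \<noteq> apply_bcontfun q x"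
    then have "linked T {x. apply_bcontfun p x \<noteq> apply_bcontfun q x} O'"
      by (intro l open_differ) simp
    then obtain a b where ab: "a \<noteq> b"
        "\<And>z. apply_bcontfun a z \<noteq> apply_bcontfun b z \<Longrightarrow> apply_bcontfun p z \<noteq> apply_bcontfun q z"
        "\<And>z. apply_bcontfun (T a) z \<noteq> apply_bcontfun (T b) z \<Longrightarrow> z \<in> O'"
      unfolding linked_def by blast
    obtain z where "apply_bcontfun a z \<noteq> apply_bcontfun b z" "apply_bcontfun p z = apply_bcontfun q z"
      by (rule agree_somewhere[OF T nt O(1) ab(3) O(2) ab(1)])
    then show False using ab(2) by blast
  qed
  have "apply_bcontfun p x = apply_bcontfun f1 x"
    using h(3) by (intro key[OF h(1)] near h SG) (auto simp: p)
  moreover have "apply_bcontfun p x = apply_bcontfun f2 x"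
    using h(6) by (intro key[OF h(4)] near' h SG) (auto simp: p)
  ultimately show False using e by (simp add: f1_def f2_def const_bcontfun.rep_eq)
qed

text \<open>
  Any point at which a perturbation inside \<open>U\<close> has an effect will do: smaller perturbations
  on the image side come from perturbations inside the closure of the given one, which is why the
  first perturbation is kept in a ball whose closure is still inside \<open>U\<close>.
\<close>

lemma linked_to_some_point:
  fixes T :: "('x::metric_space, 'e::real_normed_vector) bcontfun \<Rightarrow>
              ('y::metric_space, 'f::real_normed_vector) bcontfun"
  assumes T: "biseparating T" and nt: "\<exists>e::'e. e \<noteq> 0" "\<exists>u::'f. u \<noteq> 0"
    and U: "open U" "x \<in> U"
  obtains y where "\<And>G. open G \<Longrightarrow> y \<in> G \<Longrightarrow> linked T U G"
proof -
  obtain r where r: "r > 0" "cball x r \<subseteq> U" using U open_contains_cball by metis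
  then have "x \<in> ball x r" by simp
  then obtain f :: "('x, 'e) bcontfun" where f: "apply_bcontfun f x \<noteq> apply_bcontfun 0 x"
    "\<And>z. apply_bcontfun f z \<noteq> apply_bcontfun 0 z \<Longrightarrow> z \<in> ball x r"
    using perturbation_exists[OF nt(1) open_ball, of x x r 0] by metis
  have "T f \<noteq> T 0" using f(1) T unfolding biseparating_def by (metis bij_pointE)
  then obtain y where y: "apply_bcontfun (T f) y \<noteq> apply_bcontfun (T 0) y" by (metis bcontfun_eqI)
  have bij: "bij T" using T by (simp add: biseparating_def)
  then have inv: "inv T (T k) = k" for k by (simp add: bij_is_inj)
  show thesis
  proof (rule that[of y])
    fix G assume G: "open G" "y \<in> G"
    define W where "W = G \<inter> {y. apply_bcontfun (T f) y \<noteq> apply_bcontfun (T 0) y}"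
    have W: "open W" "y \<in> W" unfolding W_def using G y open_differ by (auto intro!: open_Int)
    obtain K where K: "apply_bcontfun K y \<noteq> apply_bcontfun (T 0) y"
      "\<And>z. apply_bcontfun K z \<noteq> apply_bcontfun (T 0) z \<Longrightarrow> z \<in> W"
      using perturbation_exists[OF nt(2) W, of "T 0"] by metis
    obtain k where k: "K = T k" using bij by (metis bij_pointE)
    have "x' \<in> U" if x': "apply_bcontfun k x' \<noteq> apply_bcontfun 0 x'" for x'
    proof -
      have "x' \<in> closure {x. apply_bcontfun (inv T (T f)) x \<noteq> apply_bcontfun (inv T (T 0)) x}"
        by (rule differ_mono[OF biseparating_inv[OF T] nt(1), of "T k"])
          (use K(2) x' in \<open>auto simp: inv k W_def\<close>)
      also have "\<dots> \<subseteq> closure (ball x r)" by (rule closure_mono) (use f(2) in \<open>auto simp: inv\<close>)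
      also have "\<dots> \<subseteq> U" using r(2) closure_minimal[OF ball_subset_cball closed_cball] by blast
      finally show ?thesis .
    qed
    moreover have "k \<noteq> 0" using K(1) k by auto
    moreover have "z \<in> G" if "apply_bcontfun (T k) z \<noteq> apply_bcontfun (T 0) z" for z
      using K(2)[of z] that by (auto simp: k W_def)
    ultimately show "linked T U G" unfolding linked_def by blast
  qed
qed

lemma corresponds_unique:
  fixes T :: "('x::metric_space, 'e::real_normed_vector) bcontfun \<Rightarrow>
              ('y::metric_space, 'f::real_normed_vector) bcontfun"
  assumes T: "biseparating T" and nt: "\<exists>e::'e. e \<noteq> 0" "\<exists>u::'f. u \<noteq> 0"
    and "corresponds T x y" "corresponds T x y'"
  shows "y = y'"
proof (rule ccontr)
  assume "y \<noteq> y'"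
  then show False
    using not_near_two_closed_sets[OF T nt, of "{y}" "{y'}" x] assms(4,5)
    unfolding corresponds_def by auto
qed

text \<open>
  Points linked to ever smaller balls around \<open>x\<close> form a sequence whose cluster points all
  correspond to \<open>x\<close>.  If there is none, every set of terms is closed, and splitting the
  sequence into two infinite parts yields two disjoint closed sets, both linked to all
  neighbourhoods of \<open>x\<close>.
\<close>

lemma corresponds_exists:
  fixes T :: "('x::metric_space, 'e::real_normed_vector) bcontfun \<Rightarrow>
              ('y::metric_space, 'f::real_normed_vector) bcontfun"
  assumes T: "biseparating T" and nt: "\<exists>e::'e. e \<noteq> 0" "\<exists>u::'f. u \<noteq> 0"
  shows "\<exists>y. corresponds T x y"
proof (rule ccontr)
  assume none: "\<nexists>y. corresponds T x y"
  define U where "U n = ball x (1 / real (Suc n))" for n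
  have U: "open (U n)" "x \<in> U n" for n by (auto simp: U_def)
  have U_mono: "U n \<subseteq> U m" if "m \<le> n" for m n
    unfolding U_def using that by (intro subset_ball) (simp add: frac_le)
  have U_small: "\<exists>n. U n \<subseteq> V" if "open V" "x \<in> V" for V
  proof -
    obtain r where r: "r > 0" "ball x r \<subseteq> V" using \<open>open V\<close> \<open>x \<in> V\<close> openE by blast
    obtain n where "1 / real (Suc n) < r" using nat_approx_posE[OF r(1)] by auto
    then have "U n \<subseteq> ball x r" unfolding U_def by (intro subset_ball) simp
    then show ?thesis using r by blast
  qed
  have "\<exists>y. \<forall>G. open G \<longrightarrow> y \<in> G \<longrightarrow> linked T (U n) G" for n
    using linked_to_some_point[OF T nt U] by metis
  then obtain y where y: "\<And>n G. open G \<Longrightarrow> y n \<in> G \<Longrightarrow> linked T (U n) G" by metis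
  have sparse: "\<exists>G N. open G \<and> w \<in> G \<and> (\<forall>n\<ge>N. y n \<notin> G)" for w
  proof -
    obtain V G where V: "open V" "x \<in> V" "open G" "w \<in> G" "\<not> linked T V G"
      using none unfolding corresponds_def by blast
    obtain N where N: "U N \<subseteq> V" using U_small V by blast
    have "y n \<notin> G" if "n \<ge> N" for n
      using y[OF V(3), of n] V(5) U_mono[OF that] N linked_mono[of T "U n" G V G] by blast
    then show ?thesis using V by blast
  qed
  have closed: "closed A" if A: "A \<subseteq> range y" for A
  proof -
    have "\<not> w islimpt A" for w
    proof
      assume "w islimpt A"
      obtain G N where G: "open G" "w \<in> G" "\<And>n. n \<ge> N \<Longrightarrow> y n \<notin> G" using sparse by blast
      have "infinite (A \<inter> G)" using \<open>w islimpt A\<close> G(1,2) islimpt_eq_acc_point by (metis Int_commute)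
      moreover have "A \<inter> G \<subseteq> y ` {..<N}"
      proof
        fix a assume a: "a \<in> A \<inter> G"
        then obtain n where n: "a = y n" using A by blast
        then have "n < N" using G(3)[of n] a by (meson IntD2 not_le)
        then show "a \<in> y ` {..<N}" using n by blast
      qed
      ultimately show False using finite_subset by blast
    qed
    then show ?thesis by (auto simp: closed_limpt)
  qed
  have near: "linked T V G" if A: "A \<subseteq> range y" "infinite A" and V: "open V" "x \<in> V" and G: "open G" "A \<subseteq> G" for A V G
  proof -
    obtain N where N: "U N \<subseteq> V" using U_small V by blast
    have "\<not> A \<subseteq> y ` {..<N}" using A(2) finite_subset by blast
    then obtain a where a: "a \<in> A" "a \<notin> y ` {..<N}" by blast
    then obtain n where "a = y n" using A(1) by blast
    then have n: "y n \<in> A" "n \<ge> N" using a by (auto simp: not_less[symmetric])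
    then have "linked T (U n) G" using y[OF G(1)] G(2) by blast
    then show ?thesis using linked_mono[of T "U n" G V G] U_mono[OF n(2)] N by blast
  qed
  have inf: "infinite (range y)"
  proof
    assume "finite (range y)"
    then obtain w where w: "infinite {n. y n = w}"
      using pigeonhole_infinite[of "UNIV :: nat set" y] by auto
    obtain G N where G: "w \<in> G" "\<And>n. n \<ge> N \<Longrightarrow> y n \<notin> G" using sparse by blast
    have "{n. y n = w} \<subseteq> {..<N}" using G not_le_imp_less by auto
    then show False using w finite_subset by blast
  qed
  obtain C :: "nat \<Rightarrow> 'y set" where C: "pairwise (\<lambda>i j. disjnt (C i) (C j)) UNIV"
      "(\<Union>i. C i) \<subseteq> range y" "\<And>i. infinite (C i)"
    using infinite_infinite_partition[OF inf] by blast
  have disj: "C 0 \<inter> C 1 = {}" using C(1) by (auto simp: pairwise_def disjnt_def)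
  have C': "C i \<subseteq> range y" "C i \<noteq> {}" for i using C(2) C(3)[of i] by auto
  show False
    by (rule not_near_two_closed_sets[OF T nt closed[OF C'(1)] C'(2) closed[OF C'(1)] C'(2) disj,
          OF near[OF C'(1) C(3)] near[OF C'(1) C(3)]])
qed

section \<open>The homeomorphism and the local form of the map\<close>

text \<open>
  If \<open>x\<close> is a limit of points mapped into a closed set \<open>S\<close>, then neighbourhoods of
  \<open>x\<close> are linked to those of \<open>S\<close> as well as to those of \<open>\<phi> x\<close>, so
  \<open>\<phi> x\<close> cannot lie outside \<open>S\<close>.
\<close>

lemma corresponding_map_continuous:
  fixes T :: "('x::metric_space, 'e::real_normed_vector) bcontfun \<Rightarrow>
              ('y::metric_space, 'f::real_normed_vector) bcontfun"
  assumes T: "biseparating T" and nt: "\<exists>e::'e. e \<noteq> 0" "\<exists>u::'f. u \<noteq> 0"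
    and \<phi>: "\<And>x. corresponds T x (\<phi> x)"
  shows "continuous_on UNIV \<phi>"
proof -
  have "closed (\<phi> -` S)" if S: "closed S" for S
  proof -
    have "closure (\<phi> -` S) \<subseteq> \<phi> -` S"
    proof (rule subsetI, rule ccontr)
      fix x assume x: "x \<in> closure (\<phi> -` S)" "x \<notin> \<phi> -` S"
      have "linked T U G" if U: "open U" "x \<in> U" and G: "open G" "S \<subseteq> G" for U G
      proof -
        obtain x' where "x' \<in> U" "\<phi> x' \<in> S" using x(1) U unfolding closure_iff_nhds_not_empty by blast
        then show ?thesis using \<phi>[of x'] U G unfolding corresponds_def by blast
      qed
      moreover have "linked T U G" if "open U" "x \<in> U" "open G" "{\<phi> x} \<subseteq> G" for U G
        using \<phi>[of x] that unfolding corresponds_def by blast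
      moreover have "S \<noteq> {}" using x(1) by auto
      moreover have "S \<inter> {\<phi> x} = {}" using x(2) by auto
      ultimately show False using not_near_two_closed_sets[OF T nt S, of "{\<phi> x}" x] by blast
    qed
    then show ?thesis by (metis closure_subset closure_eq subset_antisym)
  qed
  then show ?thesis by (simp add: continuous_on_closed_vimage)
qed

text \<open>
  This is \<open>agree_somewhere\<close> for the inverse of \<open>T\<close>: if the images differed at
  \<open>y\<close>, they would differ on a neighbourhood, and its link to \<open>U\<close> would produce a point of it where
  they agree.
\<close>

lemma local_agreement:
  fixes T :: "('x::metric_space, 'e::real_normed_vector) bcontfun \<Rightarrow>
              ('y::metric_space, 'f::real_normed_vector) bcontfun"
  assumes T: "biseparating T" and nt: "\<exists>e::'e. e \<noteq> 0" "\<exists>u::'f. u \<noteq> 0"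
    and xy: "corresponds T x y"
    and U: "open U" "x \<in> U" "\<And>z. z \<in> U \<Longrightarrow> apply_bcontfun f z = apply_bcontfun g z"
  shows "apply_bcontfun (T f) y = apply_bcontfun (T g) y"
proof (rule ccontr)
  assume neq: "apply_bcontfun (T f) y \<noteq> apply_bcontfun (T g) y"
  define V where "V = {y. apply_bcontfun (T f) y \<noteq> apply_bcontfun (T g) y}"
  have V: "open V" "y \<in> V" unfolding V_def using neq open_differ by auto
  have bij: "bij T" using T by (simp add: biseparating_def)
  then have inv: "inv T (T k) = k" for k by (simp add: bij_is_inj)
  have "linked (inv T) V U" using xy U V linked_inv[OF bij] unfolding corresponds_def by blast
  then obtain a b where ab: "a \<noteq> b" "\<And>y. apply_bcontfun a y \<noteq> apply_bcontfun b y \<Longrightarrow> y \<in> V"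
    "\<And>x. apply_bcontfun (inv T a) x \<noteq> apply_bcontfun (inv T b) x \<Longrightarrow> x \<in> U" unfolding linked_def by blast
  obtain y' where "apply_bcontfun a y' \<noteq> apply_bcontfun b y'" "apply_bcontfun (T f) y' = apply_bcontfun (T g) y'"
    by (rule agree_somewhere[OF biseparating_inv[OF T] nt(2,1) U(1) ab(3) _ ab(1), of "T f" "T g"])
      (auto simp: inv U(3))
  then show False using ab(2)[of y'] by (simp add: V_def)
qed

text \<open>
  At an accumulation point \<open>x\<close>, a function \<open>h\<close> that agrees with \<open>f\<close> near
  the even terms and with \<open>g\<close> near the odd terms of a sequence converging to \<open>x\<close>
  links the two values: \<open>T h\<close> has both as its value at \<open>\<phi> x\<close>, by continuity.
\<close>

lemma pointwise_agreement:
  fixes T :: "('x::metric_space, 'e::real_normed_vector) bcontfun \<Rightarrow>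
              ('y::metric_space, 'f::real_normed_vector) bcontfun"
  assumes T: "biseparating T" and nt: "\<exists>e::'e. e \<noteq> 0" "\<exists>u::'f. u \<noteq> 0"
    and \<phi>: "\<And>x. corresponds T x (\<phi> x)"
    and eq: "apply_bcontfun f x = apply_bcontfun g x"
  shows "apply_bcontfun (T f) (\<phi> x) = apply_bcontfun (T g) (\<phi> x)"
proof (cases "x islimpt UNIV")
  case False
  then have "open {x}" by (simp add: islimpt_UNIV_iff)
  then show ?thesis using local_agreement[OF T nt \<phi>, of "{x}" x f g] eq by auto
next
  case True
  then obtain \<sigma> where \<sigma>: "inj \<sigma>" "\<And>n. \<sigma> n \<noteq> x" "\<sigma> \<longlonglongrightarrow> x"
    using injective_sequence_to_point[of x "\<lambda>_ _. True"] unfolding islimpt_approachable by (metis UNIV_I)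
  have ev: "(\<lambda>n. \<sigma> (2 * n)) \<longlonglongrightarrow> x" and od: "(\<lambda>n. \<sigma> (2 * n + 1)) \<longlonglongrightarrow> x"
    using LIMSEQ_subseq_LIMSEQ[OF \<sigma>(3), of "\<lambda>n. 2 * n"] LIMSEQ_subseq_LIMSEQ[OF \<sigma>(3), of "\<lambda>n. 2 * n + 1"]
    by (auto simp: strict_mono_def o_def)
  define A where "A = insert x (range (\<lambda>n. \<sigma> (2 * n)))"
  define A' where "A' = insert x (range (\<lambda>n. \<sigma> (2 * n + 1)))"
  have cl: "closed A" "closed A'" unfolding A_def A'_def
    using closed_convergent_sequence[OF ev] closed_convergent_sequence[OF od] by auto
  have par: "\<sigma> (2 * n) \<noteq> \<sigma> (2 * k + 1)" for n k
    using \<sigma>(1) by (metis injD even_mult_iff even_plus_one_iff even_numeral)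
  have int: "A \<inter> A' = {x}" using par \<sigma>(2) by (auto simp: A_def A'_def)
  obtain h G G' where h: "open G" "A - A' \<subseteq> G" "\<And>z. z \<in> G \<Longrightarrow> apply_bcontfun h z = apply_bcontfun f z"
    "open G'" "A' - A \<subseteq> G'" "\<And>z. z \<in> G' \<Longrightarrow> apply_bcontfun h z = apply_bcontfun g z"
    using glue_exists[of A A' f g] cl eq int by (metis A_def A'_def insert_not_empty singletonD)
  have lim: "apply_bcontfun (T h) (\<phi> x) = apply_bcontfun (T k) (\<phi> x)"
    if O: "open O'" "\<And>z. z \<in> O' \<Longrightarrow> apply_bcontfun h z = apply_bcontfun k z"
      and s: "\<And>n. s n \<in> O'" "s \<longlonglongrightarrow> x" for k O' s
  proof -
    have "apply_bcontfun (T h) (\<phi> (s n)) = apply_bcontfun (T k) (\<phi> (s n))" for n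
      using local_agreement[OF T nt \<phi> O(1) s(1) O(2)] .
    moreover have "isCont \<phi> x" using corresponding_map_continuous[OF T nt \<phi>]
      by (simp add: continuous_on_eq_continuous_at)
    then have "(\<lambda>n. \<phi> (s n)) \<longlonglongrightarrow> \<phi> x" using s(2) by (rule isCont_tendsto_compose)
    ultimately show ?thesis
      using closed_sequentially[OF closed_agree[of "T h" "T k"], of "\<lambda>n. \<phi> (s n)" "\<phi> x"] by simp
  qed
  have "\<sigma> (2 * n) \<in> G" for n
  proof -
    have "\<sigma> (2 * n) \<in> A - A'" using int \<sigma>(2) unfolding A_def by blast
    then show ?thesis using h(2) by blast
  qed
  from lim[OF h(1,3) this ev] have 1: "apply_bcontfun (T h) (\<phi> x) = apply_bcontfun (T f) (\<phi> x)" .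
  have "\<sigma> (2 * n + 1) \<in> G'" for n
  proof -
    have "\<sigma> (2 * n + 1) \<in> A' - A" using int \<sigma>(2) unfolding A'_def by blast
    then show ?thesis using h(5) by blast
  qed
  from lim[OF h(4,6) this od] show ?thesis using 1 by simp
qed

section \<open>Regularity of the local form\<close>

text \<open>
  A failure of continuity gives points \<open>\<sigma> n\<close> converging to \<open>y\<close> and vectors
  \<open>E n\<close> converging to \<open>e\<close> whose images stay away from that of \<open>(y, e)\<close>.  A
  continuous function taking the value \<open>E n\<close> at \<open>\<psi> (\<sigma> n)\<close> would have a
  discontinuous image.  The interpolation needs the points to be distinct from each other and from
  \<open>y\<close>, which is where the assumption that \<open>y\<close> is not isolated enters.
\<close>

lemma local_form_continuous:
  fixes T :: "('x::metric_space, 'e::real_normed_vector) bcontfun \<Rightarrow>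
              ('y::metric_space, 'f::real_normed_vector) bcontfun"
  assumes rep: "\<And>f y. apply_bcontfun (T f) y = \<Phi> (y, apply_bcontfun f (\<psi> y))"
    and \<psi>: "inj \<psi>" "continuous_on UNIV \<psi>" and y: "y islimpt UNIV"
  shows "isCont \<Phi> (y, e)"
proof (rule ccontr)
  assume "\<not> isCont \<Phi> (y, e)"
  then obtain \<epsilon> where \<epsilon>: "\<epsilon> > 0"
    "\<And>d. d > 0 \<Longrightarrow> \<exists>p. dist p (y, e) < d \<and> dist (\<Phi> p) (\<Phi> (y, e)) \<ge> \<epsilon>"
    unfolding continuous_at_eps_delta by (metis not_le)
  define Q where "Q d z \<longleftrightarrow> (\<exists>e'. dist e' e < d \<and> dist (\<Phi> (z, e')) (\<Phi> (y, e)) > \<epsilon> / 2)" for d z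
  have "\<exists>z. z \<noteq> y \<and> dist z y < d \<and> Q d z" if d: "d > 0" for d
  proof -
    obtain w e' where p: "dist (w, e') (y, e) < d" "dist (\<Phi> (w, e')) (\<Phi> (y, e)) \<ge> \<epsilon>"
      using \<epsilon>(2)[OF d] by (metis surj_pair)
    have w: "dist w y < d" "dist e' e < d"
      using dist_fst_le[of "(w, e')" "(y, e)"] dist_snd_le[of "(w, e')" "(y, e)"] p(1) by auto
    show ?thesis
    proof (cases "w = y")
      case False
      then show ?thesis using w p \<epsilon>(1) unfolding Q_def by (intro exI[of _ w]) force
    next
      case True
      \<comment> \<open>The image of a constant is continuous, so that \<open>y\<close> can be exchanged for a
        point near it at the cost of half of \<open>\<epsilon>\<close>.\<close>
      let ?c = "T (const_bcontfun e')"
      have val: "apply_bcontfun ?c z = \<Phi> (z, e')" for z by (simp add: rep const_bcontfun.rep_eq)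
      have "isCont (apply_bcontfun ?c) y" by (rule isCont_apply_bcontfun)
      then obtain \<delta> where \<delta>: "\<delta> > 0" "\<And>z. dist z y < \<delta> \<Longrightarrow> dist (\<Phi> (z, e')) (\<Phi> (y, e')) < \<epsilon> / 2"
        using \<epsilon>(1) unfolding continuous_at_eps_delta val by (metis half_gt_zero)
      obtain z where z: "z \<noteq> y" "dist z y < min d \<delta>"
        using y d \<delta>(1) unfolding islimpt_approachable by (metis UNIV_I min_less_iff_conj)
      have "dist (\<Phi> (y, e')) (\<Phi> (y, e)) \<le> dist (\<Phi> (z, e')) (\<Phi> (y, e')) + dist (\<Phi> (z, e')) (\<Phi> (y, e))"
        by (metis dist_commute dist_triangle)
      then have "dist (\<Phi> (z, e')) (\<Phi> (y, e)) > \<epsilon> / 2" using \<delta>(2)[of z] z p(2) True by simp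
      then show ?thesis using z w unfolding Q_def by auto
    qed
  qed
  from injective_sequence_to_point[OF this]
  obtain \<sigma> where \<sigma>: "inj \<sigma>" "\<And>n. \<sigma> n \<noteq> y" "\<sigma> \<longlonglongrightarrow> y"
    "\<And>n. \<exists>d. 0 < d \<and> d \<le> 1 / real (Suc n) \<and> Q d (\<sigma> n)" by blast
  have "\<exists>e'. dist e' e < 1 / real (Suc n) \<and> dist (\<Phi> (\<sigma> n, e')) (\<Phi> (y, e)) > \<epsilon> / 2" for n
    using \<sigma>(4)[of n] unfolding Q_def by (meson less_le_trans)
  then obtain E where E: "\<And>n. dist (E n) e < 1 / real (Suc n)"
    "\<And>n. dist (\<Phi> (\<sigma> n, E n)) (\<Phi> (y, e)) > \<epsilon> / 2" by metis
  have "(\<lambda>n. norm (E n - e)) \<longlonglongrightarrow> 0"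
  proof (rule tendsto_sandwich[OF _ _ tendsto_const LIMSEQ_inverse_real_of_nat])
    show "\<forall>\<^sub>F n in sequentially. norm (E n - e) \<le> inverse (real (Suc n))"
      using E(1) by (intro always_eventually) (auto simp: dist_norm inverse_eq_divide less_imp_le)
  qed simp
  then have E0: "(\<lambda>n. E n - e) \<longlonglongrightarrow> 0" by (rule tendsto_norm_zero_cancel)
  define x where "x = (\<lambda>n. \<psi> (\<sigma> n))"
  have "isCont \<psi> y" using \<psi>(2) by (simp add: continuous_on_eq_continuous_at)
  then have x: "x \<longlonglongrightarrow> \<psi> y" unfolding x_def using \<sigma>(3) by (rule isCont_tendsto_compose)
  have injx: "inj x" unfolding x_def using \<sigma>(1) \<psi>(1) by (simp add: inj_def)
  have limpt: "z = \<psi> y" if "z islimpt range x" for z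
    by (rule sequence_unique_limpt[OF x that])
  have iso: "\<not> x n islimpt range x" for n
    using limpt[of "x n"] \<sigma>(2)[of n] \<psi>(1) by (auto simp: x_def inj_eq)
  have "bounded (range (\<lambda>n. E n - e))" using E0 convergent_imp_bounded by blast
  then obtain f where f: "\<And>n. apply_bcontfun f (x n) = E n - e"
    using interpolation_exists[OF injx iso, of "\<lambda>n. E n - e"] E0 by metis
  have "isCont (apply_bcontfun f) (\<psi> y)" by (rule isCont_apply_bcontfun)
  then have "(\<lambda>n. E n - e) \<longlonglongrightarrow> apply_bcontfun f (\<psi> y)" using isCont_tendsto_compose[OF _ x, of "apply_bcontfun f"] by (simp add: f)
  then have f0: "apply_bcontfun f (\<psi> y) = 0" using E0 LIMSEQ_unique by blast
  let ?h = "f + const_bcontfun e"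
  have Th: "apply_bcontfun (T ?h) (\<sigma> n) = \<Phi> (\<sigma> n, E n)" for n
    using f[of n] by (simp add: rep plus_bcontfun.rep_eq const_bcontfun.rep_eq x_def)
  have Ty: "apply_bcontfun (T ?h) y = \<Phi> (y, e)"
    by (simp add: rep plus_bcontfun.rep_eq const_bcontfun.rep_eq f0)
  have "isCont (apply_bcontfun (T ?h)) y" by (rule isCont_apply_bcontfun)
  then have "(\<lambda>n. \<Phi> (\<sigma> n, E n)) \<longlonglongrightarrow> \<Phi> (y, e)"
    using isCont_tendsto_compose[OF _ \<sigma>(3)] by (metis (no_types, lifting) Th Ty ext)
  then obtain n where "dist (\<Phi> (\<sigma> n, E n)) (\<Phi> (y, e)) < \<epsilon> / 2"
    using \<epsilon>(1) unfolding lim_sequentially by (metis half_gt_zero order_refl)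
  then show False using E(2)[of n] by simp
qed

text \<open>
  Without a convergent subsequence, infinitely many of the points \<open>\<psi> (t n)\<close> with
  \<open>n \<in> I\<close> are distinct and they have no limit point.  Then a bounded continuous function
  takes the value \<open>e n\<close> at infinitely many of them, and its image is unbounded.
\<close>

lemma local_form_bounded:
  fixes T :: "('x::metric_space, 'e::real_normed_vector) bcontfun \<Rightarrow>
              ('y::metric_space, 'f::real_normed_vector) bcontfun"
  assumes rep: "\<And>f y. apply_bcontfun (T f) y = \<Phi> (y, apply_bcontfun f (\<psi> y))"
    and I: "infinite I" and B: "bounded B"
    and e: "\<And>n. n \<in> I \<Longrightarrow> e n \<in> B" "\<And>n. n \<in> I \<Longrightarrow> norm (\<Phi> (t n, e n)) > real n"
  shows "\<exists>r. strict_mono r \<and> convergent (\<lambda>n. \<psi> (t (r n)))"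
proof (rule ccontr)
  assume none: "\<not> ?thesis"
  define s where "s = (\<lambda>n. \<psi> (t n))"
  have nosub: "\<not> convergent (s \<circ> r)" if "strict_mono r" for r :: "nat \<Rightarrow> nat"
    using none that by (auto simp: s_def o_def)
  have "infinite (s ` I)"
  proof
    assume "finite (s ` I)"
    then obtain i where "infinite {j \<in> I. s j = s i}" using pigeonhole_infinite[OF I] by blast
    then obtain r :: "nat \<Rightarrow> nat" where r: "strict_mono r" "\<And>n. r n \<in> {j \<in> I. s j = s i}"
      using infinite_enumerate by blast
    then have "s \<circ> r = (\<lambda>_. s i)" by (auto simp: fun_eq_iff)
    then have "convergent (s \<circ> r)" by (simp add: convergent_const)
    then show False using nosub r by blast
  qed
  then obtain x :: "nat \<Rightarrow> 'x" where x: "inj x" "range x \<subseteq> s ` I" using infinite_countable_subset by blast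
  have "\<exists>k\<in>I. s k = x n" for n using x(2) by (metis imageE rangeI subsetD)
  then obtain k where k: "\<And>n. k n \<in> I" "\<And>n. s (k n) = x n" by metis
  \<comment> \<open>Since \<open>k\<close> is injective, its values are unbounded, whatever order they come in.\<close>
  have injk: "inj k" using x(1) k(2) by (metis injD injI)
  have nolim: "\<not> z islimpt range x" for z
  proof
    assume "z islimpt range x"
    then have "z islimpt range s" by (rule islimpt_subset) (use x(2) in auto)
    then obtain r where "strict_mono r" "(s \<circ> r) \<longlonglongrightarrow> z"
      using islimpt_range_imp_convergent_subsequence by blast
    then show False using nosub convergentI by blast
  qed
  have "bounded (range (\<lambda>n. e (k n)))" using B by (rule bounded_subset) (use e(1) k(1) in auto)
  then obtain f where f: "\<And>n. apply_bcontfun f (x n) = e (k n)"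
    using interpolation_exists[OF x(1) nolim, of "\<lambda>n. e (k n)"] nolim by metis
  have val: "apply_bcontfun (T f) (t (k n)) = \<Phi> (t (k n), e (k n))" for n
    using f[of n] k(2)[of n] by (simp add: rep s_def)
  have le: "real (k n) < norm (T f)" for n
    using e(2)[OF k(1)[of n]] norm_bounded[of "T f" "t (k n)"] val[of n] by simp
  obtain N :: nat where N: "norm (T f) \<le> real N" using real_arch_simple by blast
  have "range k \<subseteq> {..<N}"
  proof
    fix j assume "j \<in> range k"
    then obtain n where "j = k n" by blast
    then have "real j < real N" using le[of n] N by linarith
    then show "j \<in> {..<N}" by simp
  qed
  then have "finite (range k)" using finite_subset by blast
  then show False using injk finite_imageD by blast
qed

section \<open>The characterization\<close>

lemma scaled_cball: "n \<ge> 1 \<Longrightarrow> (\<lambda>u::'a::real_normed_vector. real n *\<^sub>R u) ` cball 0 1 = {u. norm u \<le> real n}"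
  using cball_scale[of "real n" "0::'a" 1] by (auto simp: dist_norm)

lemma biseparating_local_form:
  fixes T :: "('x::metric_space, 'e::real_normed_vector) bcontfun \<Rightarrow>
              ('y::metric_space, 'f::real_normed_vector) bcontfun"
  assumes T: "biseparating T" and nt: "\<exists>e::'e. e \<noteq> 0" "\<exists>u::'f. u \<noteq> 0"
  obtains \<phi> where "homeomorphism UNIV UNIV \<phi> (inv \<phi>)" "bij \<phi>"
    "\<And>f y. apply_bcontfun (T f) y = apply_bcontfun (T (const_bcontfun (apply_bcontfun f (inv \<phi> y)))) y"
    "\<And>g x. apply_bcontfun (inv T g) x = apply_bcontfun (inv T (const_bcontfun (apply_bcontfun g (\<phi> x)))) x"
proof -
  have bij: "bij T" using T by (simp add: biseparating_def)
  note T' = biseparating_inv[OF T]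
  obtain \<phi> where \<phi>: "\<And>x. corresponds T x (\<phi> x)" using corresponds_exists[OF T nt] by metis
  obtain \<psi> where \<psi>: "\<And>y. corresponds (inv T) y (\<psi> y)" using corresponds_exists[OF T' nt(2,1)] by metis
  have 1: "\<psi> (\<phi> x) = x" for x
    using corresponds_unique[OF T' nt(2,1) \<psi>[of "\<phi> x"], of x] \<phi>[of x] corresponds_inv[OF bij] by blast
  have 2: "\<phi> (\<psi> y) = y" for y
    using corresponds_unique[OF T nt \<phi>[of "\<psi> y"], of y] \<psi>[of y] corresponds_inv[OF bij] by blast
  have b: "bij \<phi>" using 1 2 by (metis bijI')
  have inv: "inv \<phi> = \<psi>" using 1 2 by (intro inv_equality)
  show thesis
  proof (rule that[OF _ b])
    show "homeomorphism UNIV UNIV \<phi> (inv \<phi>)" unfolding inv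
      using corresponding_map_continuous[OF T nt \<phi>] corresponding_map_continuous[OF T' nt(2,1) \<psi>] 1 2
      by (intro homeomorphismI) auto
    show "apply_bcontfun (T f) y = apply_bcontfun (T (const_bcontfun (apply_bcontfun f (inv \<phi> y)))) y" for f y
      using pointwise_agreement[OF T nt \<phi>, of f "\<psi> y" "const_bcontfun (apply_bcontfun f (\<psi> y))"]
      by (simp add: inv 2 const_bcontfun.rep_eq)
    show "apply_bcontfun (inv T g) x = apply_bcontfun (inv T (const_bcontfun (apply_bcontfun g (\<phi> x)))) x" for g x
      using pointwise_agreement[OF T' nt(2,1) \<psi>, of g "\<phi> x" "const_bcontfun (apply_bcontfun g (\<phi> x))"]
      by (simp add: 1 const_bcontfun.rep_eq)
  qed
qed

text \<open>
  The type of \<open>T\<close> makes the images bounded; what has to be proved is that the preimage of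
  \<open>g\<close>, given pointwise by \<open>\<Psi>\<close>, is bounded.  Points where it exceeds
  \<open>n\<close> lie in the \<open>n\<close>-th of the sets belonging to \<open>B1 = {}\<close> and
  \<open>B2 = range g\<close>, and a continuous function cannot tend to infinity along a convergent
  sequence.
\<close>

lemma local_form_biseparating:
  fixes T :: "('x::metric_space, 'e::real_normed_vector) bcontfun \<Rightarrow>
              ('y::metric_space, 'f::real_normed_vector) bcontfun"
  assumes \<phi>: "homeomorphism UNIV UNIV \<phi> (inv \<phi>)"
    and rep: "\<And>f y. apply_bcontfun (T f) y = \<Phi> (y, apply_bcontfun f (inv \<phi> y))"
    and inv1: "\<And>x e. \<Psi> (x, \<Phi> (\<phi> x, e)) = e" and inv2: "\<And>x u. \<Phi> (\<phi> x, \<Psi> (x, u)) = u"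
    and cont: "\<And>x u. x islimpt UNIV \<Longrightarrow> isCont \<Psi> (x, u)"
    and bdd: "\<And>B2 s. bounded B2 \<Longrightarrow> \<forall>n\<ge>1. s n \<in> Zset \<phi> \<Phi> {} B2 n \<Longrightarrow>
             \<exists>r::nat \<Rightarrow> nat. strict_mono r \<and> convergent (s \<circ> r)"
  shows "biseparating T"
proof -
  have \<phi>1: "inv \<phi> (\<phi> x) = x" and \<phi>2: "\<phi> (inv \<phi> y) = y" for x y
    using \<phi> by (auto simp: homeomorphism_def)
  have c\<phi>: "continuous_on UNIV \<phi>" using \<phi> by (simp add: homeomorphism_def)
  have \<Phi>_inj: "\<Phi> (y, e) = \<Phi> (y, e') \<longleftrightarrow> e = e'" for y e e'
    using inv1[of "inv \<phi> y"] by (metis \<phi>2)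
  have agree: "apply_bcontfun (T f) y = apply_bcontfun (T g) y \<longleftrightarrow>
      apply_bcontfun f (inv \<phi> y) = apply_bcontfun g (inv \<phi> y)" for f g y
    by (simp add: rep \<Phi>_inj)
  have "inj T"
  proof (rule injI, rule bcontfun_eqI)
    fix f g x assume "T f = T g"
    then show "apply_bcontfun f x = apply_bcontfun g x" using agree[of f "\<phi> x" g] by (simp add: \<phi>1)
  qed
  moreover have "\<exists>f. T f = g" for g
  proof -
    define F where "F x = \<Psi> (x, apply_bcontfun g (\<phi> x))" for x
    have F: "\<Phi> (\<phi> x, F x) = apply_bcontfun g (\<phi> x)" for x by (simp add: F_def inv2)
    have cF: "isCont F x" for x
    proof (cases "x islimpt UNIV")
      case True
      have "isCont (\<lambda>x. apply_bcontfun g (\<phi> x)) x"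
        using c\<phi> by (auto intro!: continuous_on_interior[of UNIV] continuous_on_apply_bcontfun
            continuous_on_compose2[of UNIV "apply_bcontfun g"])
      then have "isCont (\<lambda>x. (x, apply_bcontfun g (\<phi> x))) x" by (intro continuous_intros)
      then show ?thesis unfolding F_def using cont[OF True] by (rule isCont_o2)
    next
      case False
      then have "at x = bot" using trivial_limit_within[of x UNIV] by simp
      then show ?thesis by (simp add: isCont_def)
    qed
    have "bounded (range F)"
    proof (rule ccontr)
      assume "\<not> bounded (range F)"
      then have "\<forall>n::nat. \<exists>x. norm (F x) > real n" by (auto simp: bounded_iff not_le)
      then obtain s where s: "\<And>n::nat. norm (F (s n)) > real n" by metis
      have "s n \<in> Zset \<phi> \<Phi> {} (range (apply_bcontfun g)) n" if "n \<ge> 1" for n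
      proof -
        have "apply_bcontfun g (\<phi> (s n)) \<notin> slice_image \<Phi> (\<phi> (s n)) {e. norm e \<le> real n}"
        proof
          assume "apply_bcontfun g (\<phi> (s n)) \<in> slice_image \<Phi> (\<phi> (s n)) {e. norm e \<le> real n}"
          then obtain e where "norm e \<le> real n" "\<Phi> (\<phi> (s n), F (s n)) = \<Phi> (\<phi> (s n), e)"
            by (auto simp: slice_image_def F)
          then show False using s[of n] by (simp add: \<Phi>_inj)
        qed
        then show ?thesis unfolding Zset_def scaled_cball[OF that] by blast
      qed
      moreover have "bounded (range (apply_bcontfun g))" by simp
      ultimately obtain r l where r: "strict_mono r" "(s \<circ> r) \<longlonglongrightarrow> l"
        using bdd unfolding convergent_def by metis
      have "(\<lambda>n. F ((s \<circ> r) n)) \<longlonglongrightarrow> F l" using isCont_tendsto_compose[OF cF r(2)] .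
      then have "bounded (range (\<lambda>n. F ((s \<circ> r) n)))" using convergent_imp_bounded by blast
      then obtain C where C: "\<And>n. norm (F (s (r n))) \<le> C" by (auto simp: bounded_iff)
      obtain n :: nat where "C \<le> real n" using real_arch_simple by blast
      then show False using C[of n] s[of "r n"] seq_suble[OF r(1), of n] by simp
    qed
    then have "F \<in> bcontfun" using cF by (simp add: bcontfun_def continuous_at_imp_continuous_on)
    then have "apply_bcontfun (Bcontfun F) x = F x" for x by (simp add: Bcontfun_inverse)
    then have "T (Bcontfun F) = g" by (intro bcontfun_eqI) (metis rep F \<phi>2)
    then show ?thesis by blast
  qed
  ultimately have "bij T" by (metis bijI surjI)
  moreover have "perp_at h f g \<longleftrightarrow> perp_at (T h) (T f) (T g)" for f g h
    unfolding perp_at_iff agree by (metis \<phi>1)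
  ultimately show ?thesis by (simp add: biseparating_def)
qed

theorem theorem6p4:
  fixes T :: "('x::metric_space, 'e::real_normed_vector) bcontfun \<Rightarrow>
              ('y::metric_space, 'f::real_normed_vector) bcontfun"
  assumes "\<exists>e::'e. e \<noteq> 0" and "\<exists>u::'f. u \<noteq> 0"
  shows "biseparating T \<longleftrightarrow>
    (\<exists>(\<phi> :: 'x \<Rightarrow> 'y) (\<Phi> :: 'y \<times> 'e \<Rightarrow> 'f) (\<Psi> :: 'x \<times> 'f \<Rightarrow> 'e).
       homeomorphism UNIV UNIV \<phi> (inv \<phi>) \<and>
       (\<forall>f y. apply_bcontfun (T f) y = \<Phi> (y, apply_bcontfun f (inv \<phi> y))) \<and>
       (\<forall>x y. \<phi> x = y \<longrightarrow>
          (\<forall>e. \<Psi> (x, \<Phi> (y, e)) = e) \<and> (\<forall>u. \<Phi> (y, \<Psi> (x, u)) = u)) \<and>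
       (\<forall>y e. y islimpt UNIV \<longrightarrow> isCont \<Phi> (y, e)) \<and>
       (\<forall>x u. x islimpt UNIV \<longrightarrow> isCont \<Psi> (x, u)) \<and>
       (\<forall>B1 B2. bounded B1 \<and> bounded B2 \<longrightarrow>
          (\<forall>s :: nat \<Rightarrow> 'x. (\<forall>n\<ge>1. s n \<in> Zset \<phi> \<Phi> B1 B2 n) \<longrightarrow>
             (\<exists>r. strict_mono r \<and> convergent (s \<circ> r)))))"
    (is "_ \<longleftrightarrow> ?R")
proof
  assume T: "biseparating T"
  then have bijT: "bij T" by (simp add: biseparating_def)
  obtain \<phi> where \<phi>: "homeomorphism UNIV UNIV \<phi> (inv \<phi>)" "bij \<phi>"
    "\<And>f y. apply_bcontfun (T f) y = apply_bcontfun (T (const_bcontfun (apply_bcontfun f (inv \<phi> y)))) y"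
    "\<And>g x. apply_bcontfun (inv T g) x = apply_bcontfun (inv T (const_bcontfun (apply_bcontfun g (\<phi> x)))) x"
    using biseparating_local_form[OF T assms] by metis
  define \<Phi> where "\<Phi> = (\<lambda>(y, e). apply_bcontfun (T (const_bcontfun e)) y)"
  define \<Psi> where "\<Psi> = (\<lambda>(x, u). apply_bcontfun (inv T (const_bcontfun u)) x)"
  have rep: "apply_bcontfun (T f) y = \<Phi> (y, apply_bcontfun f (inv \<phi> y))" for f y
    using \<phi>(3) by (simp add: \<Phi>_def)
  have rep': "apply_bcontfun (inv T g) x = \<Psi> (x, apply_bcontfun g (\<phi> x))" for g x
    using \<phi>(4) by (simp add: \<Psi>_def)
  have \<phi>1: "inv \<phi> (\<phi> x) = x" and \<phi>2: "\<phi> (inv \<phi> y) = y" for x y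
    using \<phi>(1) by (auto simp: homeomorphism_def)
  have c\<phi>: "continuous_on UNIV \<phi>" and c\<phi>': "continuous_on UNIV (inv \<phi>)"
    using \<phi>(1) by (simp_all add: homeomorphism_def)
  have inv1: "\<Psi> (x, \<Phi> (\<phi> x, e)) = e" for x e
  proof -
    have "\<Phi> (\<phi> x, e) = apply_bcontfun (T (const_bcontfun e)) (\<phi> x)" by (simp add: \<Phi>_def)
    then have "\<Psi> (x, \<Phi> (\<phi> x, e)) = apply_bcontfun (inv T (T (const_bcontfun e))) x" by (simp add: rep')
    then show ?thesis using bijT by (simp add: bij_is_inj const_bcontfun.rep_eq)
  qed
  have inv2: "\<Phi> (\<phi> x, \<Psi> (x, u)) = u" for x u
  proof -
    have "\<Psi> (x, u) = apply_bcontfun (inv T (const_bcontfun u)) (inv \<phi> (\<phi> x))" by (simp add: \<Psi>_def \<phi>1)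
    then have "\<Phi> (\<phi> x, \<Psi> (x, u)) = apply_bcontfun (T (inv T (const_bcontfun u))) (\<phi> x)" by (simp add: rep)
    then show ?thesis using bijT by (simp add: bij_is_surj surj_f_inv_f const_bcontfun.rep_eq)
  qed
  \<comment> \<open>Membership in infinitely many of the sets \<open>Z\<^sub>n\<close> is due infinitely often to
    \<open>\<Phi>\<close> or infinitely often to \<open>\<Psi>\<close>, and each case contradicts the boundedness of
    functions unless there is a convergent subsequence.\<close>
  have subseq: "\<exists>r. strict_mono r \<and> convergent (s \<circ> r)"
    if B: "bounded B1" "bounded B2" and s: "\<forall>n\<ge>1. s n \<in> Zset \<phi> \<Phi> B1 B2 n" for B1 B2 s
  proof -
    define I1 where "I1 = {n. \<exists>e\<in>B1. norm (\<Phi> (\<phi> (s n), e)) > real n}"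
    define I2 where "I2 = {n. \<exists>u\<in>B2. norm (\<Psi> (s n, u)) > real n}"
    have "n \<in> I1 \<union> I2" if n: "n \<ge> 1" for n
    proof (rule ccontr)
      assume neg: "n \<notin> I1 \<union> I2"
      have "slice_image \<Phi> (\<phi> (s n)) B1 \<subseteq> {u. norm u \<le> real n}"
        using neg by (auto simp: I1_def slice_image_def not_less)
      moreover have "B2 \<subseteq> slice_image \<Phi> (\<phi> (s n)) {e. norm e \<le> real n}"
      proof
        fix u assume "u \<in> B2"
        then have "norm (\<Psi> (s n, u)) \<le> real n" using neg by (auto simp: I2_def not_less)
        then show "u \<in> slice_image \<Phi> (\<phi> (s n)) {e. norm e \<le> real n}"
          unfolding slice_image_def by (intro image_eqI[of _ _ "\<Psi> (s n, u)"]) (simp_all add: inv2)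
      qed
      moreover have "s n \<in> Zset \<phi> \<Phi> B1 B2 n" using s n by blast
      ultimately show False unfolding Zset_def scaled_cball[OF n] by blast
    qed
    then have "{1..} \<subseteq> I1 \<union> I2" by auto
    then have "infinite (I1 \<union> I2)" using infinite_Ici finite_subset by blast
    then consider "infinite I1" | "infinite I2" by auto
    then show ?thesis
    proof cases
      case 1
      define e where "e n = (SOME e. e \<in> B1 \<and> norm (\<Phi> (\<phi> (s n), e)) > real n)" for n
      have e: "e n \<in> B1 \<and> norm (\<Phi> (\<phi> (s n), e n)) > real n" if "n \<in> I1" for n
        unfolding e_def by (rule someI_ex) (use that in \<open>auto simp: I1_def\<close>)
      obtain r where "strict_mono r" "convergent (\<lambda>n. inv \<phi> (\<phi> (s (r n))))"
        using local_form_bounded[OF rep 1 B(1), of e "\<lambda>n. \<phi> (s n)"] e by blast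
      then show ?thesis by (auto simp: \<phi>1 o_def)
    next
      case 2
      define u where "u n = (SOME u. u \<in> B2 \<and> norm (\<Psi> (s n, u)) > real n)" for n
      have u: "u n \<in> B2 \<and> norm (\<Psi> (s n, u n)) > real n" if "n \<in> I2" for n
        unfolding u_def by (rule someI_ex) (use that in \<open>auto simp: I2_def\<close>)
      obtain r l where r: "strict_mono r" "(\<lambda>n. \<phi> (s (r n))) \<longlonglongrightarrow> l"
        using local_form_bounded[OF rep' 2 B(2), of u s] u unfolding convergent_def by blast
      have "isCont (inv \<phi>) l" using c\<phi>' by (simp add: continuous_on_eq_continuous_at)
      from isCont_tendsto_compose[OF this r(2)] have "(s \<circ> r) \<longlonglongrightarrow> inv \<phi> l" by (simp add: \<phi>1 o_def)
      then show ?thesis using r(1) convergentI by blast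
    qed
  qed
  have c\<Phi>: "isCont \<Phi> (y, e)" if "y islimpt UNIV" for y e
    using local_form_continuous[OF rep _ c\<phi>' that] \<phi>(2) by (simp add: bij_imp_bij_inv bij_is_inj)
  have c\<Psi>: "isCont \<Psi> (x, u)" if "x islimpt UNIV" for x u
    using local_form_continuous[OF rep' _ c\<phi> that] \<phi>(2) by (simp add: bij_is_inj)
  have "\<forall>x y. \<phi> x = y \<longrightarrow> (\<forall>e. \<Psi> (x, \<Phi> (y, e)) = e) \<and> (\<forall>u. \<Phi> (y, \<Psi> (x, u)) = u)"
    using inv1 inv2 by blast
  moreover have "\<forall>f y. apply_bcontfun (T f) y = \<Phi> (y, apply_bcontfun f (inv \<phi> y))"
    using rep by blast
  moreover have "\<forall>y e. y islimpt UNIV \<longrightarrow> isCont \<Phi> (y, e)" "\<forall>x u. x islimpt UNIV \<longrightarrow> isCont \<Psi> (x, u)"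
    using c\<Phi> c\<Psi> by blast+
  moreover have "\<forall>B1 B2. bounded B1 \<and> bounded B2 \<longrightarrow>
      (\<forall>s :: nat \<Rightarrow> 'x. (\<forall>n\<ge>1. s n \<in> Zset \<phi> \<Phi> B1 B2 n) \<longrightarrow>
         (\<exists>r. strict_mono r \<and> convergent (s \<circ> r)))"
    by (intro allI impI, elim conjE, rule subseq)
  ultimately show ?R
    using \<phi>(1) by (intro exI[of _ \<phi>] exI[of _ \<Phi>] exI[of _ \<Psi>] conjI)
next
  assume ?R
  then obtain \<phi> \<Phi> \<Psi> where
    \<phi>: "homeomorphism UNIV UNIV \<phi> (inv \<phi>)"
    and rep: "\<forall>f y. apply_bcontfun (T f) y = \<Phi> (y, apply_bcontfun f (inv \<phi> y))"
    and inverse: "\<forall>x y. \<phi> x = y \<longrightarrow> (\<forall>e. \<Psi> (x, \<Phi> (y, e)) = e) \<and> (\<forall>u. \<Phi> (y, \<Psi> (x, u)) = u)"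
    and cont: "\<forall>x u. x islimpt UNIV \<longrightarrow> isCont \<Psi> (x, u)"
    and bdd: "\<forall>B1 B2. bounded B1 \<and> bounded B2 \<longrightarrow>
      (\<forall>s :: nat \<Rightarrow> 'x. (\<forall>n\<ge>1. s n \<in> Zset \<phi> \<Phi> B1 B2 n) \<longrightarrow>
         (\<exists>r. strict_mono r \<and> convergent (s \<circ> r)))"
    by (elim exE conjE) (rule that)
  show "biseparating T"
  proof (rule local_form_biseparating[OF \<phi>])
    show "apply_bcontfun (T f) y = \<Phi> (y, apply_bcontfun f (inv \<phi> y))" for f y using rep by blast
    show "\<Psi> (x, \<Phi> (\<phi> x, e)) = e" "\<Phi> (\<phi> x, \<Psi> (x, u)) = u" for x e u using inverse by blast+
    show "isCont \<Psi> (x, u)" if "x islimpt UNIV" for x u using cont that by blast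
    show "\<exists>r::nat \<Rightarrow> nat. strict_mono r \<and> convergent (s \<circ> r)"
      if "bounded B2" "\<forall>n\<ge>1. s n \<in> Zset \<phi> \<Phi> {} B2 n" for B2 s
      using bdd bounded_empty that by blast
  qed
qed

end
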